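(* Let $((A,\cdot_A),(A^*,\cdot_{A^*}))$ be a perm bialgebra, and let $(\mathfrak A=A\oplus A^*,\cdot_{\mathfrak A})$ be its double perm algebra. Let $\{e_1,\dots,e_n\}$ be a basis of $A$ and $\{e_1^*,\dots,e_n^*\}$ be the dual basis of $A^*$. Set $$r=\sum_i e_i\otimes e_i^*\in A\otimes A^*\subset\mathfrak A\otimes\mathfrak A.$$ Then $(\mathfrak A,\cdot_{\mathfrak A},\Delta_r)$ is a factorizable perm bialgebra, where $\Delta_r(x)=(\mathrm{id}\otimes R_{\cdot_{\mathfrak A}}(x)-\mathrm{ad}_{\cdot_{\mathfrak A}}(x)\otimes\mathrm{id})(r)$ for all $x\in\mathfrak A$.
   Context: Conventions: the base field $\mathbb K$ has characteristic zero; all vector spaces and algebras are finite-dimensional. For a bilinear operation $\cdot$ on $A$: $L_\cdot(a)b=a\cdot b$, $R_\cdot(a)b=b\cdot a$, $\mathrm{ad}_\cdot(a)=L_\cdot(a)-R_\cdot(a)$ (subscripts omitted when clear). For $\mu:A\to\mathrm{End}(V)$, $\mu^*:A\to\mathrm{End}(V^* )$ is $\langle\mu^*(a)v^*,v\rangle=\langle v^*,\mu(a)v\rangle$ (no sign). $\sigma(u\otimes v)=v\otimes u$. Perm algebra: a vector space $A$ with bilinear $\cdot_A$ such that $a\cdot_A(b\cdot_A c)=(a\cdot_A b)\cdot_A c=(b\cdot_A a)\cdot_A c$ for all $a,b,c\in A$. Perm coalgebra: $(A,\Delta)$ with $\Delta:A\to A\otimes A$ linear and $(\Delta\otimes\mathrm{id})\Delta=(\mathrm{id}\otimes\Delta)\Delta=(\sigma\otimes\mathrm{id})(\Delta\otimes\mathrm{id})\Delta$.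 Perm bialgebra: $(A,\cdot_A,\Delta)$ with $(A,\cdot_A)$ a perm algebra, $(A,\Delta)$ a perm coalgebra, and for all $a,b\in A$: $\Delta(a\cdot_A b)=(\mathrm{ad}(a)\otimes\mathrm{id})\Delta(b)+(\mathrm{id}\otimes R(b))\Delta(a)$; $\sigma(R(b)\otimes\mathrm{id})\Delta(a)=(R(a)\otimes\mathrm{id})\Delta(b)$; $\Delta(a\cdot_A b)=(\mathrm{id}\otimes L(a))\Delta(b)+(\mathrm{ad}(b)\otimes\mathrm{id})(\Delta(a)-\sigma\Delta(a))$. Such a perm bialgebra is also denoted $((A,\cdot_A),(A^*,\cdot_{A^*}))$, where $\cdot_{A^*}$ is the dual multiplication $\langle\Delta(a),a^*\otimes b^*\rangle=\langle a,a^*\cdot_{A^*}b^*\rangle$ (then $(A^*,\cdot_{A^*})$ is a perm algebra). Double perm algebra of $((A,\cdot_A),(A^*,\cdot_{A^*}))$: $\mathfrak A=A\oplus A^*$ with $(a+a^* )\cdot_{\mathfrak A}(b+b^* )=(a\cdot_A b+L_{\cdot_{A^*}}^*(a^* )b+\mathrm{ad}_{\cdot_{A^*}}^*(b^* )a)+(a^*\cdot_{A^*}b^*+L_{\cdot_A}^*(a)b^*+\mathrm{ad}_{\cdot_A}^*(b)a^* )$ for $a,b\in A$, $a^*,b^*\in A^*$; it is known to be a perm algebra. For a perm algebra $(B,\cdot)$ and $r=\sum_i a_i\otimes b_i\in B\otimes B$: $T_r:B^*\to B$, $T_r(x^* )=\sum_i\langle x^*,a_i\rangle b_i$; $\Delta_r(x)=(\mathrm{id}\otimes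 R(x)-\mathrm{ad}(x)\otimes\mathrm{id})(r)$. $r$ is a solution of the perm Yang-Baxter equation if $\sum_{i,j}\big(a_i\otimes b_i\cdot a_j\otimes b_j-a_i\otimes a_j\otimes b_i\cdot b_j+a_i\cdot a_j\otimes b_i\otimes b_j-a_j\cdot a_i\otimes b_i\otimes b_j\big)=0$. $s\in B\otimes B$ is $(R,\mathrm{ad})$-invariant if $(\mathrm{id}\otimes R(x)-\mathrm{ad}(x)\otimes\mathrm{id})(s)=0$ for all $x\in B$. Quasi-triangular perm bialgebra: a perm bialgebra $(B,\cdot,\Delta_r)$ where $r$ solves the perm Yang-Baxter equation and $\frac12(r-\sigma(r))$ is $(R,\mathrm{ad})$-invariant. It is factorizable if moreover $T_{r-\sigma(r)}:B^*\to B$ is a linear isomorphism. *)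

theory Defs
  imports Complex_Main "HOL-Library.Function_Algebras" "HOL-Library.Product_Plus"
begin

section \<open>Finite-dimensional spaces, linear maps, duals\<close>

text \<open>
  A vector space is given by a scalar multiplication \<open>s\<close> making a type a vector space, together with
  a carrier \<open>V\<close>, a subspace of that type. Explicit carriers are needed because the dual space and
  the double \<open>A \<times> dual_space s A\<close> are proper subspaces of their ambient types.
\<close>

definition fd_space :: "('k::field_char_0 \<Rightarrow> 'v::ab_group_add \<Rightarrow> 'v) \<Rightarrow> 'v set \<Rightarrow> bool" where
  "fd_space s V \<longleftrightarrow> vector_space s \<and> (\<exists>B. finite B \<and> module.span s B = V)"

definition linear_on ::
  "('k \<Rightarrow> 'v::plus \<Rightarrow> 'v) \<Rightarrow> ('k \<Rightarrow> 'w::plus \<Rightarrow> 'w) \<Rightarrow> 'v set \<Rightarrow> 'w set \<Rightarrow> ('v \<Rightarrow> 'w) \<Rightarrow> bool" where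
  "linear_on s s' V W f \<longleftrightarrow>
     (\<forall>x\<in>V. f x \<in> W) \<and>
     (\<forall>x\<in>V. \<forall>y\<in>V. f (x + y) = f x + f y) \<and>
     (\<forall>c. \<forall>x\<in>V. f (s c x) = s' c (f x))"

definition bilinear_on ::
  "('k \<Rightarrow> 'v::plus \<Rightarrow> 'v) \<Rightarrow> ('k \<Rightarrow> 'w::plus \<Rightarrow> 'w) \<Rightarrow> 'v set \<Rightarrow> 'w set \<Rightarrow> ('v \<Rightarrow> 'v \<Rightarrow> 'w) \<Rightarrow> bool"
  where
  "bilinear_on s s' V W m \<longleftrightarrow>
     (\<forall>a\<in>V. linear_on s s' V W (\<lambda>b. m a b)) \<and> (\<forall>b\<in>V. linear_on s s' V W (\<lambda>a. m a b))"

text \<open>Functionals on \<open>V\<close> are extended by zero outside \<open>V\<close>, so that equality of functionals on \<open>V\<close>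
  is equality of HOL functions and the vector space operations are pointwise.\<close>

definition dual_space :: "('k::field_char_0 \<Rightarrow> 'v::ab_group_add \<Rightarrow> 'v) \<Rightarrow> 'v set \<Rightarrow> ('v \<Rightarrow> 'k) set" where
  "dual_space s V = {f. linear_on s (*) V UNIV f \<and> (\<forall>x. x \<notin> V \<longrightarrow> f x = 0)}"

definition fscale :: "'k::times \<Rightarrow> ('v \<Rightarrow> 'k) \<Rightarrow> 'v \<Rightarrow> 'k" where
  "fscale c f = (\<lambda>x. c * f x)"

definition is_basis ::
  "('k::field_char_0 \<Rightarrow> 'v::ab_group_add \<Rightarrow> 'v) \<Rightarrow> 'v set \<Rightarrow> nat \<Rightarrow> (nat \<Rightarrow> 'v) \<Rightarrow> bool" where
  "is_basis s V n e \<longleftrightarrow>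
     inj_on e {1..n} \<and> \<not> module.dependent s (e ` {1..n}) \<and> module.span s (e ` {1..n}) = V"

definition is_dual_basis ::
  "('k::field_char_0 \<Rightarrow> 'v::ab_group_add \<Rightarrow> 'v) \<Rightarrow> 'v set \<Rightarrow> nat \<Rightarrow> (nat \<Rightarrow> 'v) \<Rightarrow> (nat \<Rightarrow> 'v \<Rightarrow> 'k) \<Rightarrow> bool"
  where
  "is_dual_basis s V n e e' \<longleftrightarrow>
     (\<forall>i\<in>{1..n}. e' i \<in> dual_space s V \<and> (\<forall>j\<in>{1..n}. e' i (e j) = (if i = j then 1 else 0)))"


section \<open>Tensor products\<close>

text \<open>
  Elementary tensors are realised as multilinear forms on the functionals of the ambient type:
  \<open>a \<otimes> b\<close> is \<open>(f, g) \<mapsto> f a * g b\<close>. Functionals separate points, so the finite sums of elementary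
  tensors with entries in \<open>V\<close> form a model of \<open>V \<otimes> V\<close>; the universal property is proved below
  (\<open>tensor_lift2_sum\<close>, \<open>tensor_lift3_sum\<close>). Tensors are added pointwise.
\<close>

type_synonym ('v, 'k) tensor2 = "('v \<Rightarrow> 'k) \<Rightarrow> ('v \<Rightarrow> 'k) \<Rightarrow> 'k"
type_synonym ('v, 'k) tensor3 = "('v \<Rightarrow> 'k) \<Rightarrow> ('v \<Rightarrow> 'k) \<Rightarrow> ('v \<Rightarrow> 'k) \<Rightarrow> 'k"

definition tens2 ::
  "('k::field_char_0 \<Rightarrow> 'v::ab_group_add \<Rightarrow> 'v) \<Rightarrow> 'v \<Rightarrow> 'v \<Rightarrow> ('v, 'k) tensor2" where
  "tens2 s a b = (\<lambda>f g. if f \<in> dual_space s UNIV \<and> g \<in> dual_space s UNIV then f a * g b else 0)"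

definition tens3 ::
  "('k::field_char_0 \<Rightarrow> 'v::ab_group_add \<Rightarrow> 'v) \<Rightarrow> 'v \<Rightarrow> 'v \<Rightarrow> 'v \<Rightarrow> ('v, 'k) tensor3" where
  "tens3 s a b c = (\<lambda>f g h.
     if f \<in> dual_space s UNIV \<and> g \<in> dual_space s UNIV \<and> h \<in> dual_space s UNIV
     then f a * g b * h c else 0)"

definition tscale2 :: "'k::field_char_0 \<Rightarrow> ('v, 'k) tensor2 \<Rightarrow> ('v, 'k) tensor2" where
  "tscale2 c t = (\<lambda>f g. c * t f g)"

definition tscale3 :: "'k::field_char_0 \<Rightarrow> ('v, 'k) tensor3 \<Rightarrow> ('v, 'k) tensor3" where
  "tscale3 c t = (\<lambda>f g h. c * t f g h)"

text \<open>No scalars are needed in the sums below, since \<open>c (a \<otimes> b) = (c a) \<otimes> b\<close>.\<close>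

definition tensor_square ::
  "('k::field_char_0 \<Rightarrow> 'v::ab_group_add \<Rightarrow> 'v) \<Rightarrow> 'v set \<Rightarrow> ('v, 'k) tensor2 set" where
  "tensor_square s V = {t. \<exists>xs. set xs \<subseteq> V \<times> V \<and> t = (\<Sum>(a, b)\<leftarrow>xs. tens2 s a b)}"

text \<open>The linear map out of a tensor product induced by a multilinear map \<open>\<beta>\<close>: it sends
  \<open>\<Sum> a\<^sub>i \<otimes> b\<^sub>i\<close> to \<open>\<Sum> \<beta> a\<^sub>i b\<^sub>i\<close>, for any decomposition with entries in \<open>V\<close>.\<close>

definition tensor_lift2 ::
  "('k::field_char_0 \<Rightarrow> 'v::ab_group_add \<Rightarrow> 'v) \<Rightarrow> 'v set \<Rightarrow> ('v \<Rightarrow> 'v \<Rightarrow> 'w::ab_group_add)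
    \<Rightarrow> ('v, 'k) tensor2 \<Rightarrow> 'w" where
  "tensor_lift2 s V \<beta> t = (THE w. \<exists>xs. set xs \<subseteq> V \<times> V \<and>
     t = (\<Sum>(a, b)\<leftarrow>xs. tens2 s a b) \<and> w = (\<Sum>(a, b)\<leftarrow>xs. \<beta> a b))"

definition tensor_lift3 ::
  "('k::field_char_0 \<Rightarrow> 'v::ab_group_add \<Rightarrow> 'v) \<Rightarrow> 'v set \<Rightarrow> ('v \<Rightarrow> 'v \<Rightarrow> 'v \<Rightarrow> 'w::ab_group_add)
    \<Rightarrow> ('v, 'k) tensor3 \<Rightarrow> 'w" where
  "tensor_lift3 s V \<beta> t = (THE w. \<exists>xs. set xs \<subseteq> V \<times> V \<times> V \<and>
     t = (\<Sum>(a, b, c)\<leftarrow>xs. tens3 s a b c) \<and> w = (\<Sum>(a, b, c)\<leftarrow>xs. \<beta> a b c))"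

text \<open>\<open>P \<otimes> Q\<close> and \<open>\<sigma>\<close> on \<open>V \<otimes> V\<close>; \<open>\<sigma> \<otimes> id\<close> on \<open>V \<otimes> V \<otimes> V\<close>; \<open>\<Delta> \<otimes> id\<close> and \<open>id \<otimes> \<Delta>\<close>
  from \<open>V \<otimes> V\<close> to \<open>V \<otimes> V \<otimes> V\<close>.\<close>

definition tmap ::
  "('k::field_char_0 \<Rightarrow> 'v::ab_group_add \<Rightarrow> 'v) \<Rightarrow> 'v set \<Rightarrow> ('v \<Rightarrow> 'v) \<Rightarrow> ('v \<Rightarrow> 'v)
    \<Rightarrow> ('v, 'k) tensor2 \<Rightarrow> ('v, 'k) tensor2" where
  "tmap s V P Q = tensor_lift2 s V (\<lambda>a b. tens2 s (P a) (Q b))"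

definition tflip ::
  "('k::field_char_0 \<Rightarrow> 'v::ab_group_add \<Rightarrow> 'v) \<Rightarrow> 'v set \<Rightarrow> ('v, 'k) tensor2 \<Rightarrow> ('v, 'k) tensor2" where
  "tflip s V = tensor_lift2 s V (\<lambda>a b. tens2 s b a)"

definition tflip_id ::
  "('k::field_char_0 \<Rightarrow> 'v::ab_group_add \<Rightarrow> 'v) \<Rightarrow> 'v set \<Rightarrow> ('v, 'k) tensor3 \<Rightarrow> ('v, 'k) tensor3" where
  "tflip_id s V = tensor_lift3 s V (\<lambda>a b c. tens3 s b a c)"

definition comul_id ::
  "('k::field_char_0 \<Rightarrow> 'v::ab_group_add \<Rightarrow> 'v) \<Rightarrow> 'v set \<Rightarrow> ('v \<Rightarrow> ('v, 'k) tensor2)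
    \<Rightarrow> ('v, 'k) tensor2 \<Rightarrow> ('v, 'k) tensor3" where
  "comul_id s V \<Delta> = tensor_lift2 s V (\<lambda>a b. tensor_lift2 s V (\<lambda>x y. tens3 s x y b) (\<Delta> a))"

definition id_comul ::
  "('k::field_char_0 \<Rightarrow> 'v::ab_group_add \<Rightarrow> 'v) \<Rightarrow> 'v set \<Rightarrow> ('v \<Rightarrow> ('v, 'k) tensor2)
    \<Rightarrow> ('v, 'k) tensor2 \<Rightarrow> ('v, 'k) tensor3" where
  "id_comul s V \<Delta> = tensor_lift2 s V (\<lambda>a b. tensor_lift2 s V (\<lambda>x y. tens3 s a x y) (\<Delta> b))"


section \<open>Perm algebras, coalgebras and bialgebras\<close>

definition Lop :: "('v \<Rightarrow> 'v \<Rightarrow> 'v) \<Rightarrow> 'v \<Rightarrow> 'v \<Rightarrow> 'v" where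
  "Lop m a b = m a b"

definition Rop :: "('v \<Rightarrow> 'v \<Rightarrow> 'v) \<Rightarrow> 'v \<Rightarrow> 'v \<Rightarrow> 'v" where
  "Rop m a b = m b a"

definition ad_op :: "('v::minus \<Rightarrow> 'v \<Rightarrow> 'v) \<Rightarrow> 'v \<Rightarrow> 'v \<Rightarrow> 'v" where
  "ad_op m a b = Lop m a b - Rop m a b"

definition perm_algebra ::
  "('k::field_char_0 \<Rightarrow> 'v::ab_group_add \<Rightarrow> 'v) \<Rightarrow> 'v set \<Rightarrow> ('v \<Rightarrow> 'v \<Rightarrow> 'v) \<Rightarrow> bool" where
  "perm_algebra s V m \<longleftrightarrow> fd_space s V \<and> bilinear_on s s V V m \<and>
     (\<forall>a\<in>V. \<forall>b\<in>V. \<forall>c\<in>V. m a (m b c) = m (m a b) c \<and> m (m a b) c = m (m b a) c)"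

definition perm_coalgebra ::
  "('k::field_char_0 \<Rightarrow> 'v::ab_group_add \<Rightarrow> 'v) \<Rightarrow> 'v set \<Rightarrow> ('v \<Rightarrow> ('v, 'k) tensor2) \<Rightarrow> bool" where
  "perm_coalgebra s V \<Delta> \<longleftrightarrow> fd_space s V \<and> linear_on s tscale2 V (tensor_square s V) \<Delta> \<and>
     (\<forall>a\<in>V. comul_id s V \<Delta> (\<Delta> a) = id_comul s V \<Delta> (\<Delta> a) \<and>
             id_comul s V \<Delta> (\<Delta> a) = tflip_id s V (comul_id s V \<Delta> (\<Delta> a)))"

definition perm_bialgebra ::
  "('k::field_char_0 \<Rightarrow> 'v::ab_group_add \<Rightarrow> 'v) \<Rightarrow> 'v set \<Rightarrow> ('v \<Rightarrow> 'v \<Rightarrow> 'v)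
    \<Rightarrow> ('v \<Rightarrow> ('v, 'k) tensor2) \<Rightarrow> bool" where
  "perm_bialgebra s V m \<Delta> \<longleftrightarrow> perm_algebra s V m \<and> perm_coalgebra s V \<Delta> \<and>
     (\<forall>a\<in>V. \<forall>b\<in>V.
        \<Delta> (m a b) = tmap s V (ad_op m a) id (\<Delta> b) + tmap s V id (Rop m b) (\<Delta> a) \<and>
        tflip s V (tmap s V (Rop m b) id (\<Delta> a)) = tmap s V (Rop m a) id (\<Delta> b) \<and>
        \<Delta> (m a b) = tmap s V id (Lop m a) (\<Delta> b)
                    + tmap s V (ad_op m b) id (\<Delta> a - tflip s V (\<Delta> a)))"


section \<open>The double\<close>

text \<open>The multiplication of \<open>V\<^sup>*\<close>: \<open>\<langle>f \<cdot> g, a\<rangle> = \<langle>f \<otimes> g, \<Delta> a\<rangle>\<close>.\<close>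

definition dual_mult ::
  "('k::field_char_0 \<Rightarrow> 'v::ab_group_add \<Rightarrow> 'v) \<Rightarrow> 'v set \<Rightarrow> ('v \<Rightarrow> ('v, 'k) tensor2)
    \<Rightarrow> ('v \<Rightarrow> 'k) \<Rightarrow> ('v \<Rightarrow> 'k) \<Rightarrow> 'v \<Rightarrow> 'k" where
  "dual_mult s V \<Delta> f g = (\<lambda>a. if a \<in> V then tensor_lift2 s V (\<lambda>x y. f x * g y) (\<Delta> a) else 0)"

text \<open>The transpose of an endomorphism of \<open>V\<close>, acting on \<open>V\<^sup>*\<close>; and the transpose of an endomorphism
  of \<open>V\<^sup>*\<close>, acting on \<open>V\<^sup>*\<^sup>* = V\<close>. There is no sign.\<close>

definition transpose_map :: "'v set \<Rightarrow> ('v \<Rightarrow> 'v) \<Rightarrow> ('v \<Rightarrow> 'k::zero) \<Rightarrow> 'v \<Rightarrow> 'k" where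
  "transpose_map V \<phi> f = (\<lambda>x. if x \<in> V then f (\<phi> x) else 0)"

definition transpose_dual ::
  "('k::field_char_0 \<Rightarrow> 'v::ab_group_add \<Rightarrow> 'v) \<Rightarrow> 'v set \<Rightarrow> (('v \<Rightarrow> 'k) \<Rightarrow> ('v \<Rightarrow> 'k)) \<Rightarrow> 'v \<Rightarrow> 'v" where
  "transpose_dual s V \<psi> x = (THE y. y \<in> V \<and> (\<forall>f\<in>dual_space s V. f y = \<psi> f x))"

definition double_scale ::
  "('k::field_char_0 \<Rightarrow> 'v \<Rightarrow> 'v) \<Rightarrow> 'k \<Rightarrow> 'v \<times> ('v \<Rightarrow> 'k) \<Rightarrow> 'v \<times> ('v \<Rightarrow> 'k)" where
  "double_scale s c = (\<lambda>(x, f). (s c x, fscale c f))"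

definition double_mult ::
  "('k::field_char_0 \<Rightarrow> 'v::ab_group_add \<Rightarrow> 'v) \<Rightarrow> 'v set \<Rightarrow> ('v \<Rightarrow> 'v \<Rightarrow> 'v)
    \<Rightarrow> (('v \<Rightarrow> 'k) \<Rightarrow> ('v \<Rightarrow> 'k) \<Rightarrow> 'v \<Rightarrow> 'k)
    \<Rightarrow> 'v \<times> ('v \<Rightarrow> 'k) \<Rightarrow> 'v \<times> ('v \<Rightarrow> 'k) \<Rightarrow> 'v \<times> ('v \<Rightarrow> 'k)" where
  "double_mult s V m m' = (\<lambda>(a, f) (b, g).
     (m a b + transpose_dual s V (Lop m' f) b + transpose_dual s V (ad_op m' g) a,
      m' f g + transpose_map V (Lop m a) g + transpose_map V (ad_op m b) f))"


section \<open>Factorizable perm bialgebras\<close>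

definition T_op ::
  "('k::field_char_0 \<Rightarrow> 'v::ab_group_add \<Rightarrow> 'v) \<Rightarrow> 'v set \<Rightarrow> ('v, 'k) tensor2 \<Rightarrow> ('v \<Rightarrow> 'k) \<Rightarrow> 'v" where
  "T_op s V r f = tensor_lift2 s V (\<lambda>a b. s (f a) b) r"

definition coboundary ::
  "('k::field_char_0 \<Rightarrow> 'v::ab_group_add \<Rightarrow> 'v) \<Rightarrow> 'v set \<Rightarrow> ('v \<Rightarrow> 'v \<Rightarrow> 'v) \<Rightarrow> ('v, 'k) tensor2
    \<Rightarrow> 'v \<Rightarrow> ('v, 'k) tensor2" where
  "coboundary s V m r x = tmap s V id (Rop m x) r - tmap s V (ad_op m x) id r"

definition perm_YBE ::
  "('k::field_char_0 \<Rightarrow> 'v::ab_group_add \<Rightarrow> 'v) \<Rightarrow> 'v set \<Rightarrow> ('v \<Rightarrow> 'v \<Rightarrow> 'v) \<Rightarrow> ('v, 'k) tensor2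
    \<Rightarrow> bool" where
  "perm_YBE s V m r \<longleftrightarrow>
     tensor_lift2 s V (\<lambda>a\<^sub>i b\<^sub>i. tensor_lift2 s V (\<lambda>a\<^sub>j b\<^sub>j.
         tens3 s a\<^sub>i (m b\<^sub>i a\<^sub>j) b\<^sub>j - tens3 s a\<^sub>i a\<^sub>j (m b\<^sub>i b\<^sub>j)
         + tens3 s (m a\<^sub>i a\<^sub>j) b\<^sub>i b\<^sub>j - tens3 s (m a\<^sub>j a\<^sub>i) b\<^sub>i b\<^sub>j) r) r = 0"

definition R_ad_invariant ::
  "('k::field_char_0 \<Rightarrow> 'v::ab_group_add \<Rightarrow> 'v) \<Rightarrow> 'v set \<Rightarrow> ('v \<Rightarrow> 'v \<Rightarrow> 'v) \<Rightarrow> ('v, 'k) tensor2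
    \<Rightarrow> bool" where
  "R_ad_invariant s V m t \<longleftrightarrow>
     (\<forall>x\<in>V. tmap s V id (Rop m x) t - tmap s V (ad_op m x) id t = 0)"

text \<open>Both notions refer to a chosen \<open>r\<close>; the comultiplication is \<open>coboundary s V m r\<close>.\<close>

definition quasi_triangular ::
  "('k::field_char_0 \<Rightarrow> 'v::ab_group_add \<Rightarrow> 'v) \<Rightarrow> 'v set \<Rightarrow> ('v \<Rightarrow> 'v \<Rightarrow> 'v) \<Rightarrow> ('v, 'k) tensor2
    \<Rightarrow> bool" where
  "quasi_triangular s V m r \<longleftrightarrow>
     r \<in> tensor_square s V \<and> perm_bialgebra s V m (coboundary s V m r) \<and> perm_YBE s V m r \<and>
     R_ad_invariant s V m (tscale2 (1/2) (r - tflip s V r))"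

definition factorizable ::
  "('k::field_char_0 \<Rightarrow> 'v::ab_group_add \<Rightarrow> 'v) \<Rightarrow> 'v set \<Rightarrow> ('v \<Rightarrow> 'v \<Rightarrow> 'v) \<Rightarrow> ('v, 'k) tensor2
    \<Rightarrow> bool" where
  "factorizable s V m r \<longleftrightarrow> quasi_triangular s V m r \<and>
     linear_on fscale s (dual_space s V) V (T_op s V (r - tflip s V r)) \<and>
     bij_betw (T_op s V (r - tflip s V r)) (dual_space s V) V"


section \<open>Universal property of the tensor model\<close>

lemma fd_space_coordinates:
  assumes "fd_space s V"
  obtains B \<rho> where "finite B" "B \<subseteq> V" "\<And>b. b \<in> B \<Longrightarrow> \<rho> b \<in> dual_space s UNIV"
    "\<And>v. v \<in> V \<Longrightarrow> (\<Sum>b\<in>B. s (\<rho> b v) b) = v"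
proof -
  interpret vector_space s using assms by (simp add: fd_space_def)
  obtain S where S: "finite S" "span S = V" using assms by (auto simp: fd_space_def)
  obtain B where B: "B \<subseteq> S" "independent B" "S \<subseteq> span B"
    using maximal_independent_subset[of S] by blast
  have sB: "span B = V" using B S span_mono[OF B(1)] span_minimal[OF B(3)] by auto
  have fB: "finite B" using B S finite_subset by blast
  let ?E = "extend_basis B"
  define \<rho> where "\<rho> = (\<lambda>b v. representation ?E v b)"
  have E: "independent ?E" "span ?E = UNIV" "B \<subseteq> ?E"
    using B(2) independent_extend_basis span_extend_basis extend_basis_superset by auto
  have "\<rho> b \<in> dual_space s UNIV" for b
    unfolding dual_space_def linear_on_def \<rho>_def using E
    by (auto simp: representation_add representation_scale)
  moreover have "(\<Sum>b\<in>B. s (\<rho> b v) b) = v" if "v \<in> V" for v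
  proof -
    have v: "v \<in> span B" using that sB by simp
    have "representation ?E v = representation B v"
      using representation_extend[OF E(1) v E(3)] .
    then show ?thesis unfolding \<rho>_def
      using sum_representation_eq[OF B(2) v fB] by simp
  qed
  moreover have "B \<subseteq> V" using B S sB span_superset by blast
  ultimately show thesis using that fB by blast
qed

lemma linear_on_sum:
  assumes "vector_space s" "vector_space s'" "module.subspace s V" "linear_on s s' V W f"
    "finite B" "B \<subseteq> V"
  shows "f (\<Sum>b\<in>B. s (c b) b) = (\<Sum>b\<in>B. s' (c b) (f b))"
proof -
  interpret v: vector_space s by fact
  interpret w: vector_space s' by fact
  show ?thesis using assms(5,6)
  proof (induction B rule: finite_induct)
    case empty
    have "f (s 0 0) = s' 0 (f 0)" using assms(3,4) v.subspace_0 unfolding linear_on_def by blast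
    then show ?case by simp
  next
    case (insert b B)
    have "(\<Sum>b\<in>B. s (c b) b) \<in> V" "s (c b) b \<in> V"
      using insert.prems assms(3) by (auto intro!: v.subspace_sum v.subspace_scale)
    then show ?case using insert assms(4) unfolding linear_on_def by simp
  qed
qed

lemma fd_space_subspace: "fd_space s V \<Longrightarrow> module.subspace s V"
  unfolding fd_space_def using module.subspace_span module_iff_vector_space by blast

lemma tensor_lift2_sum:
  assumes V: "fd_space s V" and W: "vector_space s'" and \<beta>: "bilinear_on s s' V UNIV \<beta>"
    and xs: "set xs \<subseteq> V \<times> V"
  shows "tensor_lift2 s V \<beta> (\<Sum>(a, b)\<leftarrow>xs. tens2 s a b) = (\<Sum>(a, b)\<leftarrow>xs. \<beta> a b)"
proof -
  interpret w: vector_space s' by fact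
  have vs: "vector_space s" using V by (simp add: fd_space_def)
  note sub = fd_space_subspace[OF V]
  obtain B \<rho> where B: "finite B" "B \<subseteq> V" "\<And>b. b \<in> B \<Longrightarrow> \<rho> b \<in> dual_space s UNIV"
    "\<And>v. v \<in> V \<Longrightarrow> (\<Sum>b\<in>B. s (\<rho> b v) b) = v"
    using fd_space_coordinates[OF V] by blast
  have ex: "\<beta> a b = (\<Sum>u\<in>B. \<Sum>v\<in>B. s' (tens2 s a b (\<rho> u) (\<rho> v)) (\<beta> u v))"
    if "a \<in> V" "b \<in> V" for a b
  proof -
    have "\<beta> (\<Sum>u\<in>B. s (\<rho> u a) u) b = (\<Sum>u\<in>B. s' (\<rho> u a) (\<beta> u b))"
      by (rule linear_on_sum[OF vs W sub, where W=UNIV and f="\<lambda>x. \<beta> x b"])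
         (use B that \<beta> in \<open>auto simp: bilinear_on_def\<close>)
    also have "\<dots> = (\<Sum>u\<in>B. s' (\<rho> u a) (\<Sum>v\<in>B. s' (\<rho> v b) (\<beta> u v)))"
    proof (rule sum.cong)
      fix u assume u: "u \<in> B"
      have "\<beta> u (\<Sum>v\<in>B. s (\<rho> v b) v) = (\<Sum>v\<in>B. s' (\<rho> v b) (\<beta> u v))"
        by (rule linear_on_sum[OF vs W sub, where W=UNIV and f="\<lambda>x. \<beta> u x"])
           (use B u that \<beta> in \<open>auto simp: bilinear_on_def\<close>)
      then show "s' (\<rho> u a) (\<beta> u b) = s' (\<rho> u a) (\<Sum>v\<in>B. s' (\<rho> v b) (\<beta> u v))"
        using B(4)[OF that(2)] by simp
    qed simp
    finally show ?thesis using B that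
      by (simp add: tens2_def w.scale_sum_right)
  qed
  have exs: "(\<Sum>(a, b)\<leftarrow>ys. \<beta> a b) =
      (\<Sum>u\<in>B. \<Sum>v\<in>B. s' ((\<Sum>(a, b)\<leftarrow>ys. tens2 s a b) (\<rho> u) (\<rho> v)) (\<beta> u v))"
    if "set ys \<subseteq> V \<times> V" for ys using that
    by (induction ys) (auto simp: ex w.scale_left_distrib sum.distrib)
  show ?thesis unfolding tensor_lift2_def
  proof (rule the_equality)
    show "\<exists>ys. set ys \<subseteq> V \<times> V \<and> (\<Sum>(a, b)\<leftarrow>xs. tens2 s a b) = (\<Sum>(a, b)\<leftarrow>ys. tens2 s a b) \<and>
       (\<Sum>(a, b)\<leftarrow>xs. \<beta> a b) = (\<Sum>(a, b)\<leftarrow>ys. \<beta> a b)" using xs by blast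
  qed (use exs xs in auto)
qed

lemma tensor_lift3_sum:
  assumes V: "fd_space s V" and W: "vector_space s'"
    and \<beta>1: "\<And>b c. b \<in> V \<Longrightarrow> c \<in> V \<Longrightarrow> linear_on s s' V UNIV (\<lambda>a. \<beta> a b c)"
    and \<beta>2: "\<And>a c. a \<in> V \<Longrightarrow> c \<in> V \<Longrightarrow> linear_on s s' V UNIV (\<lambda>b. \<beta> a b c)"
    and \<beta>3: "\<And>a b. a \<in> V \<Longrightarrow> b \<in> V \<Longrightarrow> linear_on s s' V UNIV (\<lambda>c. \<beta> a b c)"
    and xs: "set xs \<subseteq> V \<times> V \<times> V"
  shows "tensor_lift3 s V \<beta> (\<Sum>(a, b, c)\<leftarrow>xs. tens3 s a b c) = (\<Sum>(a, b, c)\<leftarrow>xs. \<beta> a b c)"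
proof -
  interpret w: vector_space s' by fact
  have vs: "vector_space s" using V by (simp add: fd_space_def)
  note sub = fd_space_subspace[OF V]
  obtain B \<rho> where B: "finite B" "B \<subseteq> V" "\<And>b. b \<in> B \<Longrightarrow> \<rho> b \<in> dual_space s UNIV"
    "\<And>v. v \<in> V \<Longrightarrow> (\<Sum>b\<in>B. s (\<rho> b v) b) = v"
    using fd_space_coordinates[OF V] by blast
  have ex1: "\<beta> a b c = (\<Sum>u\<in>B. s' (\<rho> u a) (\<beta> u b c))" if "a \<in> V" "b \<in> V" "c \<in> V" for a b c
    using linear_on_sum[OF vs W sub \<beta>1[OF that(2,3)] B(1,2), of "\<lambda>u. \<rho> u a"] B(4)[OF that(1)]
    by simp
  have ex2: "\<beta> a b c = (\<Sum>u\<in>B. s' (\<rho> u b) (\<beta> a u c))" if "a \<in> V" "b \<in> V" "c \<in> V" for a b c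
    using linear_on_sum[OF vs W sub \<beta>2[OF that(1,3)] B(1,2), of "\<lambda>u. \<rho> u b"] B(4)[OF that(2)]
    by simp
  have ex3: "\<beta> a b c = (\<Sum>u\<in>B. s' (\<rho> u c) (\<beta> a b u))" if "a \<in> V" "b \<in> V" "c \<in> V" for a b c
    using linear_on_sum[OF vs W sub \<beta>3[OF that(1,2)] B(1,2), of "\<lambda>u. \<rho> u c"] B(4)[OF that(3)]
    by simp
  have ex: "\<beta> a b c =
      (\<Sum>u\<in>B. \<Sum>v\<in>B. \<Sum>z\<in>B. s' (tens3 s a b c (\<rho> u) (\<rho> v) (\<rho> z)) (\<beta> u v z))"
    if "a \<in> V" "b \<in> V" "c \<in> V" for a b c
  proof -
    have "\<beta> a b c = (\<Sum>u\<in>B. s' (\<rho> u a) (\<beta> u b c))" using ex1 that by blast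
    also have "\<dots> = (\<Sum>u\<in>B. s' (\<rho> u a) (\<Sum>v\<in>B. s' (\<rho> v b) (\<beta> u v c)))"
      by (intro sum.cong refl arg_cong2[where f=s'] ex2) (use B(2) that in auto)
    also have "\<dots> = (\<Sum>u\<in>B. s' (\<rho> u a) (\<Sum>v\<in>B. s' (\<rho> v b) (\<Sum>z\<in>B. s' (\<rho> z c) (\<beta> u v z))))"
      by (intro sum.cong refl arg_cong2[where f=s'] ex3) (use B(2) that in auto)
    finally show ?thesis using B that
      by (simp add: tens3_def w.scale_sum_right mult.assoc)
  qed
  have exs: "(\<Sum>(a, b, c)\<leftarrow>ys. \<beta> a b c) =
      (\<Sum>u\<in>B. \<Sum>v\<in>B. \<Sum>z\<in>B.
         s' ((\<Sum>(a, b, c)\<leftarrow>ys. tens3 s a b c) (\<rho> u) (\<rho> v) (\<rho> z)) (\<beta> u v z))"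
    if "set ys \<subseteq> V \<times> V \<times> V" for ys using that
    by (induction ys) (auto simp: ex w.scale_left_distrib sum.distrib)
  show ?thesis unfolding tensor_lift3_def
  proof (rule the_equality)
    show "\<exists>ys. set ys \<subseteq> V \<times> V \<times> V \<and>
       (\<Sum>(a, b, c)\<leftarrow>xs. tens3 s a b c) = (\<Sum>(a, b, c)\<leftarrow>ys. tens3 s a b c) \<and>
       (\<Sum>(a, b, c)\<leftarrow>xs. \<beta> a b c) = (\<Sum>(a, b, c)\<leftarrow>ys. \<beta> a b c)" using xs by blast
  qed (use exs xs in auto)
qed

end

(* Write D for the double, the sum of A and its dual. The form B((a,f),(b,g)) = g(a) - f(b) on D is
   skew and nondegenerate, and satisfies B(xy,z) = B(x, yz - zy). With P, Q the projections of D onto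
   A and its dual, the tensor r pairs with B(u,-) and B(v,-) to B(Qu,v), so every tensor identity for r
   becomes an identity between products in D. In particular r - sigma(r) pairs to B(u,v), which gives
   its invariance and the bijectivity of T; and the product dual to the comultiplication of r becomes
   (u,v) |-> (Pu)(Pv) - (Qu)(Qv), a direct sum of two perm products, hence perm. *)
theory Submission
  imports Defs
begin

text \<open>That the double is a perm algebra is itself proved, and this is the one place that needs
  long computation: tested against a functional or at a vector, the failure of each perm law is an
  explicit sum of evaluations, and it is a combination of the compatibility conditions of the
  bialgebra. What follows uses only the form, the two projections and a pair of dual families, so it
  is carried out for an abstract triple in which \<open>A\<close> and its dual no longer appear. It
  stays short because \<open>u \<mapsto> B(u,-)\<close> identifies the space with its dual:
  transposes of \<open>L\<close>, \<open>R\<close> and \<open>ad\<close> become multiplications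
  again, so no dual space remains in the calculations. The formal obstacle is that tensors are
  functions on functionals of the ambient type, whereas a functional on a proper subspace, extended
  by zero, is in general not linear there. Pairings are therefore built from the universal property
  and then shown to separate tensors.\<close>

section \<open>Tensor calculus through pairings with functionals\<close>

text \<open>Tensors are functions, and unification eta-expands them, so these simp rules would turn a sum of
  tensors into an abstraction to which no additivity rule applies.\<close>

lemmas fun_apply = plus_fun_apply zero_fun_apply minus_apply uminus_apply

declare fun_apply [simp del]

lemma vector_space_mult: "vector_space ((*) :: 'k::field \<Rightarrow> 'k \<Rightarrow> 'k)"
  by unfold_locales (auto simp: algebra_simps)

lemma vector_space_fscale: "vector_space (fscale :: 'k::field \<Rightarrow> ('v \<Rightarrow> 'k)
  \<Rightarrow> 'v \<Rightarrow> 'k)"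
  by unfold_locales (auto simp: fun_apply fscale_def fun_eq_iff algebra_simps)

lemma vector_space_tscale2:
  "vector_space (tscale2 :: 'k::field_char_0 \<Rightarrow> ('v, 'k) tensor2 \<Rightarrow> ('v, 'k)
    tensor2)"
  by unfold_locales (auto simp: fun_apply tscale2_def fun_eq_iff algebra_simps)

lemma vector_space_tscale3:
  "vector_space (tscale3 :: 'k::field_char_0 \<Rightarrow> ('v, 'k) tensor3 \<Rightarrow> ('v, 'k)
    tensor3)"
  by unfold_locales (auto simp: fun_apply tscale3_def fun_eq_iff algebra_simps)

lemma bilinear_onI:
  assumes "\<And>a b. a \<in> V \<Longrightarrow> b \<in> V \<Longrightarrow> \<beta> a b \<in> W"
    and "\<And>a a' b. a \<in> V \<Longrightarrow> a' \<in> V \<Longrightarrow> b \<in> V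
      \<Longrightarrow> \<beta> (a + a') b = \<beta> a b + \<beta> a' b"
    and "\<And>c a b. a \<in> V \<Longrightarrow> b \<in> V \<Longrightarrow> \<beta> (s c a) b =
      s' c (\<beta> a b)"
    and "\<And>a b b'. a \<in> V \<Longrightarrow> b \<in> V \<Longrightarrow> b' \<in> V
      \<Longrightarrow> \<beta> a (b + b') = \<beta> a b + \<beta> a b'"
    and "\<And>c a b. a \<in> V \<Longrightarrow> b \<in> V \<Longrightarrow> \<beta> a (s c b) =
      s' c (\<beta> a b)"
  shows "bilinear_on s s' V W \<beta>"
  using assms by (auto simp: bilinear_on_def linear_on_def)

lemma bilinear_onD:
  assumes "bilinear_on s s' V W \<beta>"
  shows "\<And>a b. a \<in> V \<Longrightarrow> b \<in> V \<Longrightarrow> \<beta> a b \<in> W"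
    and "\<And>a a' b. a \<in> V \<Longrightarrow> a' \<in> V \<Longrightarrow> b \<in> V
      \<Longrightarrow> \<beta> (a + a') b = \<beta> a b + \<beta> a' b"
    and "\<And>c a b. a \<in> V \<Longrightarrow> b \<in> V \<Longrightarrow> \<beta> (s c a) b =
      s' c (\<beta> a b)"
    and "\<And>a b b'. a \<in> V \<Longrightarrow> b \<in> V \<Longrightarrow> b' \<in> V
      \<Longrightarrow> \<beta> a (b + b') = \<beta> a b + \<beta> a b'"
    and "\<And>c a b. a \<in> V \<Longrightarrow> b \<in> V \<Longrightarrow> \<beta> a (s c b) =
      s' c (\<beta> a b)"
  using assms by (auto simp: bilinear_on_def linear_on_def)

lemma linear_onI:
  assumes "\<And>x. x \<in> V \<Longrightarrow> f x \<in> W"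
    and "\<And>x y. x \<in> V \<Longrightarrow> y \<in> V \<Longrightarrow> f (x + y) = f x + f y"
    and "\<And>c x. x \<in> V \<Longrightarrow> f (s c x) = s' c (f x)"
  shows "linear_on s s' V W f"
  using assms by (auto simp: linear_on_def)

lemma linear_onD:
  assumes "linear_on s s' V W f"
  shows "\<And>x. x \<in> V \<Longrightarrow> f x \<in> W"
    and "\<And>x y. x \<in> V \<Longrightarrow> y \<in> V \<Longrightarrow> f (x + y) = f x + f y"
    and "\<And>c x. x \<in> V \<Longrightarrow> f (s c x) = s' c (f x)"
  using assms by (auto simp: linear_on_def)

lemma dual_spaceD:
  assumes "f \<in> dual_space s V"
  shows "\<And>x y. x \<in> V \<Longrightarrow> y \<in> V \<Longrightarrow> f (x + y) = f x + f y"
    and "\<And>c x. x \<in> V \<Longrightarrow> f (s c x) = c * f x"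
    and "\<And>x. x \<notin> V \<Longrightarrow> f x = 0"
  using assms by (auto simp: dual_space_def linear_on_def)

lemma dual_space_eqI:
  assumes "f \<in> dual_space s V" "g \<in> dual_space s V" "\<And>x. x \<in> V \<Longrightarrow> f
    x = g x"
  shows "f = g"
proof
  show "f x = g x" for x using assms dual_spaceD(3)[OF assms(1)] dual_spaceD(3)[OF assms(2)]
    by (cases "x \<in> V") auto
qed

definition tensor_cube ::
  "('k::field_char_0 \<Rightarrow> 'v::ab_group_add \<Rightarrow> 'v) \<Rightarrow> 'v set
    \<Rightarrow> ('v, 'k) tensor3 set" where
  "tensor_cube s V = {t. \<exists>xs. set xs \<subseteq> V \<times> V \<times> V \<and> t =
    (\<Sum>(a, b, c)\<leftarrow>xs. tens3 s a b c)}"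

text \<open>Not simply \<open>t f g\<close>: a nonzero functional on a proper subspace
  \<open>V\<close>, extended by zero, is not linear on the whole type, and \<open>tens2\<close>
  vanishes on such arguments. The universal property gives the intended value.\<close>

definition pair2 ::
  "('k::field_char_0 \<Rightarrow> 'v::ab_group_add \<Rightarrow> 'v) \<Rightarrow> 'v set
    \<Rightarrow> ('v \<Rightarrow> 'k) \<Rightarrow> ('v \<Rightarrow> 'k)
    \<Rightarrow> ('v, 'k) tensor2 \<Rightarrow> 'k" where
  "pair2 s V f g = tensor_lift2 s V (\<lambda>x y. f x * g y)"

definition pair3 ::
  "('k::field_char_0 \<Rightarrow> 'v::ab_group_add \<Rightarrow> 'v) \<Rightarrow> 'v set
    \<Rightarrow> ('v \<Rightarrow> 'k) \<Rightarrow> ('v \<Rightarrow> 'k) \<Rightarrow> ('v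
    \<Rightarrow> 'k)
    \<Rightarrow> ('v, 'k) tensor3 \<Rightarrow> 'k" where
  "pair3 s V f g h = tensor_lift3 s V (\<lambda>x y z. f x * g y * h z)"

text \<open>Only decompositions with entries in \<open>V\<close> enter a lift, so both sides are
  definite descriptions of the same predicate.\<close>

lemma tensor_lift2_cong:
  assumes "\<And>a b. a \<in> V \<Longrightarrow> b \<in> V \<Longrightarrow> \<beta> a b =
    \<gamma> a b"
  shows "tensor_lift2 s V \<beta> t = tensor_lift2 s V \<gamma> t"
proof -
  have "(\<Sum>(a, b)\<leftarrow>xs. \<beta> a b) = (\<Sum>(a, b)\<leftarrow>xs. \<gamma> a b)" if
    "set xs \<subseteq> V \<times> V" for xs
    using that assms by (induction xs) auto
  then show ?thesis unfolding tensor_lift2_def by (intro arg_cong[where f=The]) (auto simp: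
    fun_eq_iff)
qed

section \<open>Tensors over a fixed finite-dimensional space\<close>

locale fd_vs =
  fixes s :: "'k::field_char_0 \<Rightarrow> 'v::ab_group_add \<Rightarrow> 'v" and V :: "'v set"
  assumes fd: "fd_space s V"
begin

sublocale vector_space s using fd by (simp add: fd_space_def)

lemma sub_V: "subspace V" by (rule fd_space_subspace[OF fd])

lemma V_closed [simp]: "0 \<in> V" "a \<in> V \<Longrightarrow> b \<in> V \<Longrightarrow> a + b
  \<in> V" "a \<in> V \<Longrightarrow> s c a \<in> V"
  "a \<in> V \<Longrightarrow> - a \<in> V" "a \<in> V \<Longrightarrow> b \<in> V
    \<Longrightarrow> a - b \<in> V"
  using sub_V by (auto simp: subspace_0 subspace_add subspace_scale subspace_neg subspace_diff)

abbreviation "V' \<equiv> dual_space s V"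
abbreviation "TS \<equiv> tensor_square s V"
abbreviation "TC \<equiv> tensor_cube s V"
abbreviation "pr \<equiv> pair2 s V"
abbreviation "pr3 \<equiv> pair3 s V"

lemma dual_zero: "f \<in> V' \<Longrightarrow> f 0 = 0"
  using dual_spaceD(2)[of f s V 0 0] by simp

lemma dual_minus: "f \<in> V' \<Longrightarrow> a \<in> V \<Longrightarrow> f (- a) = - f a"
  using dual_spaceD(2)[of f s V a "-1"] by simp

lemma dual_diff: "f \<in> V' \<Longrightarrow> a \<in> V \<Longrightarrow> b \<in> V
  \<Longrightarrow> f (a - b) = f a - f b"
  using dual_spaceD(1)[of f s V a "- b"] dual_minus[of f b] by simp

lemma dual_closed [simp]:
  "0 \<in> V'" "f \<in> V' \<Longrightarrow> g \<in> V' \<Longrightarrow> f + g \<in> V'" "f \<in>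
    V' \<Longrightarrow> fscale c f \<in> V'"
  "f \<in> V' \<Longrightarrow> - f \<in> V'" "f \<in> V' \<Longrightarrow> g \<in> V'
    \<Longrightarrow> f - g \<in> V'"
  by (auto simp: dual_space_def linear_on_def fun_apply fscale_def algebra_simps)

lemma tens2_add [simp]:
  "tens2 s (a + a') b = tens2 s a b + tens2 s a' b"
  "tens2 s a (b + b') = tens2 s a b + tens2 s a b'"
  "tens2 s (s c a) b = tscale2 c (tens2 s a b)"
  "tens2 s a (s c b) = tscale2 c (tens2 s a b)"
  by (auto simp: fun_apply tens2_def fun_eq_iff tscale2_def algebra_simps dual_spaceD[where V=UNIV])

lemma tens3_add [simp]:
  "tens3 s (a + a') b d = tens3 s a b d + tens3 s a' b d"
  "tens3 s a (b + b') d = tens3 s a b d + tens3 s a b' d"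
  "tens3 s a b (d + d') = tens3 s a b d + tens3 s a b d'"
  "tens3 s (s c a) b d = tscale3 c (tens3 s a b d)"
  "tens3 s a (s c b) d = tscale3 c (tens3 s a b d)"
  "tens3 s a b (s c d) = tscale3 c (tens3 s a b d)"
  by (auto simp: fun_apply tens3_def fun_eq_iff tscale3_def algebra_simps dual_spaceD[where V=UNIV])

lemma tscale_add: "tscale2 c (t + t') = tscale2 c t + tscale2 c t'" "tscale2 c 0 = 0"
  "tscale3 c (u + u') = tscale3 c u + tscale3 c u'" "tscale3 c 0 = 0"
  by (auto simp: tscale2_def fun_apply tscale3_def fun_apply fun_eq_iff algebra_simps)

lemma TS_I: "set xs \<subseteq> V \<times> V \<Longrightarrow> (\<Sum>(a, b)\<leftarrow>xs. tens2 s
  a b) \<in> TS"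
  by (auto simp: tensor_square_def)

lemma TS_0 [simp]: "0 \<in> TS" using TS_I[of "[]"] by simp
lemma TS_tens [simp]: "a \<in> V \<Longrightarrow> b \<in> V \<Longrightarrow> tens2 s a b \<in>
  TS" using TS_I[of "[(a,b)]"] by simp

lemma TS_add [simp]: assumes "t \<in> TS" "u \<in> TS" shows "t + u \<in> TS"
proof -
  obtain xs ys where "set xs \<subseteq> V \<times> V" "t = (\<Sum>(a, b)\<leftarrow>xs. tens2 s a
    b)"
    "set ys \<subseteq> V \<times> V" "u = (\<Sum>(a, b)\<leftarrow>ys. tens2 s a b)"
    using assms by (auto simp: tensor_square_def)
  then show ?thesis using TS_I[of "xs @ ys"] by simp
qed

text \<open>Scalars can be absorbed into the first factor, so addition of elementary tensors reaches
  the whole square. The induction spares the choice of a decomposition.\<close>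

lemma TS_induct [consumes 1, case_names zero add]:
  assumes t: "t \<in> TS" and 0: "P 0"
    and add: "\<And>a b t. a \<in> V \<Longrightarrow> b \<in> V \<Longrightarrow> t \<in> TS
      \<Longrightarrow> P t \<Longrightarrow> P (tens2 s a b + t)"
  shows "P t"
proof -
  have "P (\<Sum>(a, b)\<leftarrow>xs. tens2 s a b)" if "set xs \<subseteq> V \<times> V" for xs
    using that
    by (induction xs) (auto intro!: 0 add TS_I)
  then show ?thesis using t by (auto simp: tensor_square_def)
qed

lemma TS_scale [simp]: "t \<in> TS \<Longrightarrow> tscale2 c t \<in> TS"
proof (induction t rule: TS_induct)
  case (add a b t)
  then show ?case using TS_add[OF TS_tens[of "s c a" b], of "tscale2 c t"] by (simp add: tscale_add)
qed (simp add: tscale_add)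

lemma TS_uminus [simp]: "t \<in> TS \<Longrightarrow> - t \<in> TS"
proof -
  have "tscale2 (-1) t = - t" by (simp add: tscale2_def fun_apply fun_eq_iff)
  then show "t \<in> TS \<Longrightarrow> - t \<in> TS" using TS_scale[of t "-1"] by simp
qed

lemma TS_diff [simp]: "t \<in> TS \<Longrightarrow> u \<in> TS \<Longrightarrow> t - u \<in> TS"
  using TS_add[of t "- u"] by simp

lemma TS_sum: "(\<And>i. i \<in> I \<Longrightarrow> f i \<in> TS) \<Longrightarrow>
  (\<Sum>i\<in>I. f i) \<in> TS"
  by (induction I rule: infinite_finite_induct) auto

lemma subspace_TS: "module.subspace tscale2 TS"
proof -
  interpret t: vector_space "tscale2 :: 'k \<Rightarrow> ('v, 'k) tensor2 \<Rightarrow> _" by (rule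
    vector_space_tscale2)
  show ?thesis by (rule t.subspaceI) auto
qed

lemma TC_I: "set xs \<subseteq> V \<times> V \<times> V \<Longrightarrow> (\<Sum>(a, b,
  c)\<leftarrow>xs. tens3 s a b c) \<in> TC"
  by (auto simp: tensor_cube_def)

lemma TC_0 [simp]: "0 \<in> TC" using TC_I[of "[]"] by simp
lemma TC_tens [simp]: "a \<in> V \<Longrightarrow> b \<in> V \<Longrightarrow> c \<in> V
  \<Longrightarrow> tens3 s a b c \<in> TC"
  using TC_I[of "[(a,b,c)]"] by simp

lemma TC_add [simp]: assumes "t \<in> TC" "u \<in> TC" shows "t + u \<in> TC"
proof -
  obtain xs ys where "set xs \<subseteq> V \<times> V \<times> V" "t = (\<Sum>(a, b,
    c)\<leftarrow>xs. tens3 s a b c)"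
    "set ys \<subseteq> V \<times> V \<times> V" "u = (\<Sum>(a, b, c)\<leftarrow>ys. tens3 s a b
      c)"
    using assms by (auto simp: tensor_cube_def)
  then show ?thesis using TC_I[of "xs @ ys"] by simp
qed

lemma TC_induct [consumes 1, case_names zero add]:
  assumes t: "t \<in> TC" and 0: "P 0"
    and add: "\<And>a b c t. a \<in> V \<Longrightarrow> b \<in> V \<Longrightarrow> c \<in> V
      \<Longrightarrow> t \<in> TC \<Longrightarrow> P t \<Longrightarrow> P (tens3 s a b c + t)"
  shows "P t"
proof -
  have "P (\<Sum>(a, b, c)\<leftarrow>xs. tens3 s a b c)" if "set xs \<subseteq> V \<times> V
    \<times> V" for xs using that
    by (induction xs) (auto intro!: 0 add TC_I)
  then show ?thesis using t by (auto simp: tensor_cube_def)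
qed

lemma TC_scale [simp]: "t \<in> TC \<Longrightarrow> tscale3 c t \<in> TC"
proof (induction t rule: TC_induct)
  case (add a b d t)
  then show ?case using TC_add[OF TC_tens[of "s c a" b d], of "tscale3 c t"] by (simp add:
    tscale_add)
qed (simp add: tscale_add)

lemma TC_uminus [simp]: "t \<in> TC \<Longrightarrow> - t \<in> TC"
proof -
  have "tscale3 (-1) t = - t" by (simp add: tscale3_def fun_apply fun_eq_iff)
  then show "t \<in> TC \<Longrightarrow> - t \<in> TC" using TC_scale[of t "-1"] by simp
qed

lemma TC_diff [simp]: "t \<in> TC \<Longrightarrow> u \<in> TC \<Longrightarrow> t - u \<in> TC"
  using TC_add[of t "- u"] by simp

lemma subspace_TC: "module.subspace tscale3 TC"
proof -
  interpret t: vector_space "tscale3 :: 'k \<Rightarrow> ('v, 'k) tensor3 \<Rightarrow> _" by (rule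
    vector_space_tscale3)
  show ?thesis by (rule t.subspaceI) auto
qed

section \<open>Linear maps out of the tensor square\<close>

context
  fixes s' :: "'k \<Rightarrow> 'w::ab_group_add \<Rightarrow> 'w" and \<beta>
  assumes W: "vector_space s'" and \<beta>: "bilinear_on s s' V UNIV \<beta>"
begin

lemma lift2_0: "tensor_lift2 s V \<beta> 0 = 0"
  using tensor_lift2_sum[OF fd W \<beta>, of "[]"] by simp

lemma lift2_tens: "a \<in> V \<Longrightarrow> b \<in> V \<Longrightarrow> tensor_lift2 s V \<beta>
  (tens2 s a b) = \<beta> a b"
  using tensor_lift2_sum[OF fd W \<beta>, of "[(a, b)]"] by simp

text \<open>Concatenated decompositions of \<open>t\<close> and \<open>u\<close> decompose
  \<open>t + u\<close>, and \<open>tensor_lift2_sum\<close> evaluates the lift on any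
  decomposition.\<close>

lemma lift2_add:
  assumes "t \<in> TS" "u \<in> TS"
  shows "tensor_lift2 s V \<beta> (t + u) = tensor_lift2 s V \<beta> t + tensor_lift2 s V \<beta> u"
proof -
  obtain xs ys where xs: "set xs \<subseteq> V \<times> V" "t = (\<Sum>(a, b)\<leftarrow>xs. tens2
    s a b)"
    "set ys \<subseteq> V \<times> V" "u = (\<Sum>(a, b)\<leftarrow>ys. tens2 s a b)"
    using assms by (auto simp: tensor_square_def)
  have "t + u = (\<Sum>(a, b)\<leftarrow>xs @ ys. tens2 s a b)" using xs by simp
  then show ?thesis using tensor_lift2_sum[OF fd W \<beta>] xs by (simp del: map_append
    sum_list_append) simp
qed

lemma lift2_add_tens:
  assumes "a \<in> V" "b \<in> V" "t \<in> TS"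
  shows "tensor_lift2 s V \<beta> (tens2 s a b + t) = \<beta> a b + tensor_lift2 s V \<beta> t"
  using assms by (simp add: lift2_add lift2_tens)

lemma lift2_scale:
  assumes "t \<in> TS"
  shows "tensor_lift2 s V \<beta> (tscale2 c t) = s' c (tensor_lift2 s V \<beta> t)"
  using assms
proof (induction t rule: TS_induct)
  case zero
  interpret w: vector_space s' by (rule W)
  show ?case by (simp add: lift2_0 tscale_add)
next
  case (add a b t)
  interpret w: vector_space s' by (rule W)
  have "tscale2 c (tens2 s a b + t) = tens2 s (s c a) b + tscale2 c t" by (simp add: tscale_add)
  then show ?case using add
    by (simp only: lift2_add_tens V_closed TS_scale bilinear_onD(3)[OF \<beta>]
      w.scale_right_distrib)
qed

lemma lift2_linear: "linear_on tscale2 s' TS UNIV (tensor_lift2 s V \<beta>)"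
  by (rule linear_onI) (auto simp: lift2_add lift2_scale)

lemma lift2_closed:
  assumes "module.subspace s' W" "\<And>a b. a \<in> V \<Longrightarrow> b \<in> V
    \<Longrightarrow> \<beta> a b \<in> W" "t \<in> TS"
  shows "tensor_lift2 s V \<beta> t \<in> W"
proof -
  interpret w: vector_space s' by (rule W)
  show ?thesis using assms(3)
    by (induction t rule: TS_induct)
       (auto simp: lift2_0 lift2_add_tens w.subspace_0 w.subspace_add assms(1,2))
qed

text \<open>A linear map after a lift is the lift of the composite. Linearity of
  \<open>\<phi>\<close> is asked on a subspace containing the values because the pairings
  \<open>pr\<close> and \<open>pr3\<close> are shown to be linear only on tensors over
  \<open>V\<close>.\<close>

lemma lift2_compose:
  assumes sW: "module.subspace s' W" and \<beta>W: "\<And>a b. a \<in> V \<Longrightarrow> b \<in>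
    V \<Longrightarrow> \<beta> a b \<in> W"
    and t: "t \<in> TS" and X: "vector_space s''" and \<phi>: "linear_on s' s'' W UNIV \<phi>"
  shows "\<phi> (tensor_lift2 s V \<beta> t) = tensor_lift2 s V (\<lambda>a b. \<phi> (\<beta> a
    b)) t"
proof -
  interpret w: vector_space s' by (rule W)
  interpret x: vector_space s'' by (rule X)
  have bil: "bilinear_on s s'' V UNIV (\<lambda>a b. \<phi> (\<beta> a b))"
    by (rule bilinear_onI) (auto simp: bilinear_onD[OF \<beta>] linear_onD[OF \<phi>] \<beta>W)
  have "\<phi> (s' 0 0) = s'' 0 (\<phi> 0)" using linear_onD(3)[OF \<phi>] w.subspace_0[OF sW] by
    blast
  then have \<phi>0: "\<phi> 0 = 0" by simp
  have s: "tensor_lift2 s V \<beta> (\<Sum>(a, b)\<leftarrow>xs. tens2 s a b) \<in> W \<and>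
    \<phi> (tensor_lift2 s V \<beta> (\<Sum>(a, b)\<leftarrow>xs. tens2 s a b)) = (\<Sum>(a,
      b)\<leftarrow>xs. \<phi> (\<beta> a b))"
    if "set xs \<subseteq> V \<times> V" for xs
    using that
    by (induction xs)
       (auto simp: lift2_0 \<phi>0 lift2_add_tens TS_I \<beta>W w.subspace_0[OF sW]
         w.subspace_add[OF sW] linear_onD[OF \<phi>])
  obtain xs where "set xs \<subseteq> V \<times> V" "t = (\<Sum>(a, b)\<leftarrow>xs. tens2 s a b)"
    using t by (auto simp: tensor_square_def)
  then show ?thesis using s tensor_lift2_sum[OF fd X bil] by simp
qed

end

lemma lift2_diff:
  assumes W: "vector_space s'" and \<beta>: "bilinear_on s s' V UNIV \<beta>" and "t \<in> TS" "u
    \<in> TS"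
  shows "tensor_lift2 s V \<beta> (t - u) = tensor_lift2 s V \<beta> t - tensor_lift2 s V \<beta> u"
  using lift2_add[OF W \<beta>, of "t - u" u] assms by simp

lemma lift2_sum_family:
  assumes W: "vector_space s'" and \<beta>: "bilinear_on s s' V UNIV \<beta>"
    and pq: "\<And>i. i \<in> I \<Longrightarrow> p i \<in> V" "\<And>i. i \<in> I
      \<Longrightarrow> q i \<in> V"
  shows "tensor_lift2 s V \<beta> (\<Sum>i\<in>I. tens2 s (p i) (q i)) = (\<Sum>i\<in>I. \<beta> (p
    i) (q i))"
  using pq by (induction I rule: infinite_finite_induct)
    (auto simp: lift2_0[OF W \<beta>] lift2_add_tens[OF W \<beta>] TS_sum)

text \<open>Additivity in the bilinear map rather than in the tensor. It makes the inner lift of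
  \<open>comul_id\<close> and \<open>id_comul\<close> additive in the factor that is merely carried
  along.\<close>

lemma lift2_fun_add:
  assumes W: "vector_space s'" and \<beta>: "bilinear_on s s' V UNIV \<beta>" and \<gamma>:
    "bilinear_on s s' V UNIV \<gamma>"
    and t: "t \<in> TS"
  shows "tensor_lift2 s V (\<lambda>a b. \<beta> a b + \<gamma> a b) t = tensor_lift2 s V \<beta> t
    + tensor_lift2 s V \<gamma> t"
proof -
  interpret w: vector_space s' by (rule W)
  have bil: "bilinear_on s s' V UNIV (\<lambda>a b. \<beta> a b + \<gamma> a b)"
    by (rule bilinear_onI)
       (simp_all add: bilinear_onD[OF \<beta>] bilinear_onD[OF \<gamma>] w.scale_right_distrib
         algebra_simps)
  show ?thesis using t
    by (induction t rule: TS_induct)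
       (simp_all add: lift2_0[OF W] lift2_add_tens[OF W] bil \<beta> \<gamma>)
qed

lemma lift2_fun_scale:
  assumes W: "vector_space s'" and \<beta>: "bilinear_on s s' V UNIV \<beta>" and t: "t \<in> TS"
  shows "tensor_lift2 s V (\<lambda>a b. s' c (\<beta> a b)) t = s' c (tensor_lift2 s V \<beta> t)"
proof -
  interpret w: vector_space s' by (rule W)
  show ?thesis
    by (rule lift2_compose[OF W \<beta> w.subspace_UNIV _ t W, symmetric])
       (auto intro!: linear_onI simp: w.scale_right_distrib mult.commute)
qed

section \<open>Pairings and separation of tensors\<close>

lemma pr_bil: "f \<in> V' \<Longrightarrow> g \<in> V' \<Longrightarrow> bilinear_on s (*) V UNIV
  (\<lambda>x y. f x * g y)"
  by (rule bilinear_onI) (auto simp: dual_spaceD algebra_simps)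

lemma pr_linear: "f \<in> V' \<Longrightarrow> g \<in> V' \<Longrightarrow> linear_on tscale2 (*)
  TS UNIV (pr f g)"
  unfolding pair2_def by (rule lift2_linear[OF vector_space_mult pr_bil])

lemma pr_simps:
  assumes "f \<in> V'" "g \<in> V'"
  shows "pr f g 0 = 0" "a \<in> V \<Longrightarrow> b \<in> V \<Longrightarrow> pr f g (tens2 s a
    b) = f a * g b"
    "t \<in> TS \<Longrightarrow> u \<in> TS \<Longrightarrow> pr f g (t + u) = pr f g t + pr f g u"
    "t \<in> TS \<Longrightarrow> u \<in> TS \<Longrightarrow> pr f g (t - u) = pr f g t - pr f g u"
    "t \<in> TS \<Longrightarrow> pr f g (tscale2 c t) = c * pr f g t"
  unfolding pair2_def
  using lift2_0[OF vector_space_mult pr_bil[OF assms]]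
    lift2_tens[OF vector_space_mult pr_bil[OF assms]] lift2_add[OF vector_space_mult pr_bil[OF
      assms]]
    lift2_diff[OF vector_space_mult pr_bil[OF assms]] lift2_scale[OF vector_space_mult pr_bil[OF
      assms]]
  by auto

text \<open>Linearity in the functionals, from which the bilinearity of the dual product is
  obtained.\<close>

lemma pr_fun:
  assumes t: "t \<in> TS"
  shows "f \<in> V' \<Longrightarrow> f' \<in> V' \<Longrightarrow> g \<in> V' \<Longrightarrow> pr
    (f + f') g t = pr f g t + pr f' g t"
    "f \<in> V' \<Longrightarrow> f' \<in> V' \<Longrightarrow> g \<in> V' \<Longrightarrow> pr f
      (g + f') t = pr f g t + pr f f' t"
    "f \<in> V' \<Longrightarrow> g \<in> V' \<Longrightarrow> pr (fscale c f) g t = c * pr f g t"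
    "f \<in> V' \<Longrightarrow> g \<in> V' \<Longrightarrow> pr f (fscale c g) t = c * pr f g t"
  using t by (induction t rule: TS_induct) (simp_all add: pr_simps algebra_simps fun_apply
    fscale_def[of _ f, THEN fun_cong] fscale_def[of _ g, THEN fun_cong])

text \<open>Passes from linear functionals of the ambient type, the arguments of a tensor, to
  functionals on \<open>V\<close> extended by zero, the arguments of a pairing.\<close>

definition "restr F = (\<lambda>x. if x \<in> V then F x else 0)"

lemma restr: "F \<in> dual_space s UNIV \<Longrightarrow> restr F \<in> V'"
  unfolding dual_space_def linear_on_def restr_def by auto

lemma tens2_apply: "tens2 s a b F G = (if F \<in> dual_space s UNIV \<and> G \<in> dual_space s
  UNIV then F a * G b else 0)"
  by (simp add: tens2_def)

lemma TS_eval: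
  assumes "t \<in> TS"
  shows "F \<in> dual_space s UNIV \<Longrightarrow> G \<in> dual_space s UNIV \<Longrightarrow> t
    F G = pr (restr F) (restr G) t"
    "\<not> (F \<in> dual_space s UNIV \<and> G \<in> dual_space s UNIV) \<Longrightarrow> t F G =
      0"
  using assms by (induction t rule: TS_induct) (simp_all add: pr_simps restr fun_apply tens2_apply,
    auto simp: restr_def)

text \<open>By \<open>TS_eval\<close> the value of a tensor at ambient functionals depends only on
  their restrictions to \<open>V\<close>, and off the linear functionals it is zero.\<close>

lemma TS_eqI:
  assumes "t \<in> TS" "u \<in> TS" "\<And>f g. f \<in> V' \<Longrightarrow> g \<in> V'
    \<Longrightarrow> pr f g t = pr f g u"
  shows "t = u"
proof (intro ext)
  fix F G
  show "t F G = u F G" using TS_eval[OF assms(1), of F G] TS_eval[OF assms(2), of F G] assms(3)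
    restr
    by (cases "F \<in> dual_space s UNIV \<and> G \<in> dual_space s UNIV") auto
qed

section \<open>Tensors of degree three\<close>

context
  fixes s' :: "'k \<Rightarrow> 'w::ab_group_add \<Rightarrow> 'w" and \<beta>
  assumes W: "vector_space s'"
    and \<beta>1: "\<And>b c. b \<in> V \<Longrightarrow> c \<in> V \<Longrightarrow> linear_on s
      s' V UNIV (\<lambda>a. \<beta> a b c)"
    and \<beta>2: "\<And>a c. a \<in> V \<Longrightarrow> c \<in> V \<Longrightarrow> linear_on s
      s' V UNIV (\<lambda>b. \<beta> a b c)"
    and \<beta>3: "\<And>a b. a \<in> V \<Longrightarrow> b \<in> V \<Longrightarrow> linear_on s
      s' V UNIV (\<lambda>c. \<beta> a b c)"
begin

lemma lift3_0: "tensor_lift3 s V \<beta> 0 = 0"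
  using tensor_lift3_sum[OF fd W \<beta>1 \<beta>2 \<beta>3, of "[]"] by simp

lemma lift3_tens: "a \<in> V \<Longrightarrow> b \<in> V \<Longrightarrow> c \<in> V
  \<Longrightarrow> tensor_lift3 s V \<beta> (tens3 s a b c) = \<beta> a b c"
  using tensor_lift3_sum[OF fd W \<beta>1 \<beta>2 \<beta>3, of "[(a, b, c)]"] by simp

lemma lift3_add:
  assumes "t \<in> TC" "u \<in> TC"
  shows "tensor_lift3 s V \<beta> (t + u) = tensor_lift3 s V \<beta> t + tensor_lift3 s V \<beta> u"
proof -
  obtain xs ys where xs: "set xs \<subseteq> V \<times> V \<times> V" "t = (\<Sum>(a, b,
    c)\<leftarrow>xs. tens3 s a b c)"
    "set ys \<subseteq> V \<times> V \<times> V" "u = (\<Sum>(a, b, c)\<leftarrow>ys. tens3 s a b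
      c)"
    using assms by (auto simp: tensor_cube_def)
  have "t + u = (\<Sum>(a, b, c)\<leftarrow>xs @ ys. tens3 s a b c)" using xs by simp
  then show ?thesis using tensor_lift3_sum[OF fd W \<beta>1 \<beta>2 \<beta>3] xs
    by (simp del: map_append sum_list_append) simp
qed

lemma lift3_add_tens:
  assumes "a \<in> V" "b \<in> V" "c \<in> V" "t \<in> TC"
  shows "tensor_lift3 s V \<beta> (tens3 s a b c + t) = \<beta> a b c + tensor_lift3 s V \<beta> t"
  using assms by (simp add: lift3_add lift3_tens)

lemma lift3_scale:
  assumes "t \<in> TC"
  shows "tensor_lift3 s V \<beta> (tscale3 c t) = s' c (tensor_lift3 s V \<beta> t)"
  using assms
proof (induction t rule: TC_induct)
  case zero
  interpret w: vector_space s' by (rule W)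
  show ?case by (simp add: lift3_0 tscale_add)
next
  case (add a b d t)
  interpret w: vector_space s' by (rule W)
  have "tscale3 c (tens3 s a b d + t) = tens3 s (s c a) b d + tscale3 c t" by (simp add: tscale_add)
  then show ?case using add
    by (simp only: lift3_add_tens V_closed TC_scale linear_onD(3)[OF \<beta>1]
      w.scale_right_distrib)
qed

end

lemma pr3_lin:
  assumes "f \<in> V'" "g \<in> V'" "h \<in> V'"
  shows "linear_on s (*) V UNIV (\<lambda>a. f a * g b * h c)" "linear_on s (*) V UNIV (\<lambda>b.
    f a * g b * h c)"
   "linear_on s (*) V UNIV (\<lambda>c. f a * g b * h c)"
  using assms by (auto intro!: linear_onI simp: dual_spaceD algebra_simps)

lemma pr3_simps:
  assumes "f \<in> V'" "g \<in> V'" "h \<in> V'"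
  shows "pr3 f g h 0 = 0"
    "a \<in> V \<Longrightarrow> b \<in> V \<Longrightarrow> c \<in> V \<Longrightarrow> pr3 f g h
      (tens3 s a b c) = f a * g b * h c"
    "t \<in> TC \<Longrightarrow> u \<in> TC \<Longrightarrow> pr3 f g h (t + u) = pr3 f g h t +
      pr3 f g h u"
    "t \<in> TC \<Longrightarrow> pr3 f g h (tscale3 k t) = k * pr3 f g h t"
  unfolding pair3_def
  using lift3_0[OF vector_space_mult pr3_lin[OF assms]]
    lift3_tens[OF vector_space_mult pr3_lin[OF assms]] lift3_add[OF vector_space_mult pr3_lin[OF
      assms]]
    lift3_scale[OF vector_space_mult pr3_lin[OF assms]]
  by auto

lemma pr3_diff:
  assumes "f \<in> V'" "g \<in> V'" "h \<in> V'" "t \<in> TC" "u \<in> TC"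
  shows "pr3 f g h (t - u) = pr3 f g h t - pr3 f g h u"
  using pr3_simps(3)[OF assms(1-3), of "t - u" u] assms by simp

lemma pr3_linear:
  assumes "f \<in> V'" "g \<in> V'" "h \<in> V'"
  shows "linear_on tscale3 (*) TC UNIV (pr3 f g h)"
  by (rule linear_onI) (auto simp: pr3_simps assms)

lemma tens3_apply: "tens3 s a b c F G H = (if F \<in> dual_space s UNIV \<and> G \<in> dual_space s
  UNIV
   \<and> H \<in> dual_space s UNIV then F a * G b * H c else 0)"
  by (simp add: tens3_def)

lemma TC_eval:
  assumes "t \<in> TC"
  shows "F \<in> dual_space s UNIV \<Longrightarrow> G \<in> dual_space s UNIV \<Longrightarrow> H
    \<in> dual_space s UNIV
      \<Longrightarrow> t F G H = pr3 (restr F) (restr G) (restr H) t"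
    "\<not> (F \<in> dual_space s UNIV \<and> G \<in> dual_space s UNIV \<and> H \<in> dual_space s
      UNIV) \<Longrightarrow> t F G H = 0"
  using assms by (induction t rule: TC_induct) (simp_all add: pr3_simps restr fun_apply
    tens3_apply, auto simp: restr_def)

lemma TC_eqI:
  assumes "t \<in> TC" "u \<in> TC" "\<And>f g h. f \<in> V' \<Longrightarrow> g \<in> V'
    \<Longrightarrow> h \<in> V' \<Longrightarrow> pr3 f g h t = pr3 f g h u"
  shows "t = u"
proof (intro ext)
  fix F G H
  show "t F G H = u F G H"
    using TC_eval[OF assms(1), of F G H] TC_eval[OF assms(2), of F G H] assms(3) restr
    by (cases "F \<in> dual_space s UNIV \<and> G \<in> dual_space s UNIV \<and> H \<in> dual_space
      s UNIV") auto
qed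

end

section \<open>Perm bialgebras in terms of the dual multiplication\<close>

lemma linear_on_id: "linear_on s s V V id"
  by (simp add: linear_on_def)

lemma transpose_map_id: "f \<in> dual_space s V \<Longrightarrow> transpose_map V id f = f"
  by (auto simp: transpose_map_def fun_eq_iff dual_spaceD(3))

lemma transpose_map_dual:
  assumes "linear_on s s V V P" "f \<in> dual_space s V" "module.subspace s V" "vector_space s"
  shows "transpose_map V P f \<in> dual_space s V"
proof -
  interpret vector_space s by fact
  show ?thesis
    using subspace_add[OF assms(3)] subspace_scale[OF assms(3)]
    by (auto simp: dual_space_def[of s V] transpose_map_def intro!: linear_onI
      simp: linear_onD[OF assms(1)] dual_spaceD[OF assms(2)])
qed

context fd_vs
begin

lemma transpose_V' [simp]: "linear_on s s V V P \<Longrightarrow> f \<in> V' \<Longrightarrow>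
  transpose_map V P f \<in> V'"
  by (rule transpose_map_dual[OF _ _ sub_V vector_space_axioms])

lemma transpose_apply: "x \<in> V \<Longrightarrow> transpose_map V P f x = f (P x)"
  by (simp add: transpose_map_def)

context
  fixes P Q assumes P: "linear_on s s V V P" and Q: "linear_on s s V V Q"
begin

lemma tmap_bil: "bilinear_on s tscale2 V UNIV (\<lambda>a b. tens2 s (P a) (Q b))"
  by (rule bilinear_onI) (auto simp: linear_onD[OF P] linear_onD[OF Q])

lemma tmap_closed: "t \<in> TS \<Longrightarrow> tmap s V P Q t \<in> TS"
  unfolding tmap_def
  by (rule lift2_closed[OF vector_space_tscale2 tmap_bil subspace_TS])
     (auto simp: linear_onD[OF P] linear_onD[OF Q])

text \<open>Pairing is linear and can be pushed inside the lift; on elementary tensors it moves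
  \<open>P\<close> and \<open>Q\<close> onto the functionals.\<close>

lemma pr_tmap:
  assumes "t \<in> TS" "f \<in> V'" "g \<in> V'"
  shows "pr f g (tmap s V P Q t) = pr (transpose_map V P f) (transpose_map V Q g) t"
proof -
  have "pr f g (tmap s V P Q t) = tensor_lift2 s V (\<lambda>a b. pr f g (tens2 s (P a) (Q b))) t"
    unfolding tmap_def
    by (rule lift2_compose[OF vector_space_tscale2 tmap_bil subspace_TS _ _ vector_space_mult
      pr_linear])
       (auto simp: linear_onD[OF P] linear_onD[OF Q] assms)
  also have "\<dots> = pr (transpose_map V P f) (transpose_map V Q g) t" unfolding pair2_def[of s V
    "transpose_map V P f"]
    by (rule tensor_lift2_cong)
       (auto simp: linear_onD[OF P] linear_onD[OF Q] assms pr_simps transpose_apply)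
  finally show ?thesis .
qed

end

lemma tflip_bil: "bilinear_on s tscale2 V UNIV (\<lambda>a b. tens2 s b a)"
  by (rule bilinear_onI) auto

lemma tflip_closed: "t \<in> TS \<Longrightarrow> tflip s V t \<in> TS"
  unfolding tflip_def
  by (rule lift2_closed[OF vector_space_tscale2 tflip_bil subspace_TS]) auto

lemma pr_tflip:
  assumes "t \<in> TS" "f \<in> V'" "g \<in> V'"
  shows "pr f g (tflip s V t) = pr g f t"
proof -
  have "pr f g (tflip s V t) = tensor_lift2 s V (\<lambda>a b. pr f g (tens2 s b a)) t"
    unfolding tflip_def
    by (rule lift2_compose[OF vector_space_tscale2 tflip_bil subspace_TS _ _ vector_space_mult
      pr_linear])
       (auto simp: assms)
  also have "\<dots> = pr g f t" unfolding pair2_def[of s V g f]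
    by (rule tensor_lift2_cong) (auto simp: assms pr_simps)
  finally show ?thesis .
qed

lemma tflip_id_TC:
  assumes "t \<in> TC"
  shows tflip_id_closed: "tflip_id s V t \<in> TC"
    and pr3_tflip_id: "f \<in> V' \<Longrightarrow> g \<in> V' \<Longrightarrow> h \<in> V'
      \<Longrightarrow> pr3 f g h (tflip_id s V t) = pr3 g f h t"
proof -
  have l: "linear_on s tscale3 V UNIV (\<lambda>a. tens3 s b a c)" "linear_on s tscale3 V UNIV
    (\<lambda>b. tens3 s b a c)"
    "linear_on s tscale3 V UNIV (\<lambda>c. tens3 s b a c)" for a b c
    by (auto intro!: linear_onI)
  note L = lift3_0[OF vector_space_tscale3 l] lift3_add_tens[OF vector_space_tscale3 l]
  show "tflip_id s V t \<in> TC" unfolding tflip_id_def using assms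
    by (induction t rule: TC_induct) (auto simp: L)
  show "pr3 f g h (tflip_id s V t) = pr3 g f h t" if "f \<in> V'" "g \<in> V'" "h \<in> V'"
  proof -
    \<comment> \<open>Membership in \<open>TC\<close> is carried through the induction because
      \<open>pr3\<close> is additive only on \<open>TC\<close>.\<close>
    have "tflip_id s V t \<in> TC \<and> pr3 f g h (tflip_id s V t) = pr3 g f h t"
      unfolding tflip_id_def using assms
      by (induction t rule: TC_induct) (auto simp: L pr3_simps that mult.commute mult.left_commute)
    then show ?thesis by simp
  qed
qed

section \<open>Coproducts and their dual products\<close>

context
  fixes \<Delta> assumes \<Delta>: "linear_on s tscale2 V TS \<Delta>"
begin

abbreviation "dm \<equiv> dual_mult s V \<Delta>"

lemma dm_apply: "a \<in> V \<Longrightarrow> dm f g a = pr f g (\<Delta> a)"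
  by (simp add: dual_mult_def pair2_def)

lemma dm_closed [simp]: "f \<in> V' \<Longrightarrow> g \<in> V' \<Longrightarrow> dm f g \<in> V'"
  unfolding dual_space_def[of s V, THEN eqset_imp_iff, of "dm f g"]
  by (auto intro!: linear_onI simp: dm_apply linear_onD[OF \<Delta>] pr_simps) (auto simp:
    dual_mult_def)

lemma tens3_bil:
  "bilinear_on s tscale3 V UNIV (\<lambda>x y. tens3 s x y b)" "bilinear_on s tscale3 V UNIV
    (\<lambda>x y. tens3 s b x y)"
  by (auto intro!: bilinear_onI)

text \<open>Pairing with \<open>f\<close>, \<open>g\<close>, \<open>h\<close> contracts the inner
  coproduct with \<open>f\<close> and \<open>g\<close>, and that contraction is the dual product.
  Coassociativity thus becomes associativity of \<open>dm\<close>.\<close>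

lemma comul_id_TC:
  assumes t: "t \<in> TS"
  shows comul_id_closed: "comul_id s V \<Delta> t \<in> TC"
    and pr3_comul_id: "f \<in> V' \<Longrightarrow> g \<in> V' \<Longrightarrow> h \<in> V'
      \<Longrightarrow> pr3 f g h (comul_id s V \<Delta> t) = pr (dm f g) h t"
proof -
  let ?\<beta> = "\<lambda>a b. tensor_lift2 s V (\<lambda>x y. tens3 s x y b) (\<Delta> a)"
  have bil: "bilinear_on s tscale3 V UNIV ?\<beta>"
    by (rule bilinear_onI) (auto simp: linear_onD[OF \<Delta>] lift2_add[OF vector_space_tscale3
      tens3_bil(1)]
       lift2_scale[OF vector_space_tscale3 tens3_bil(1)]
       lift2_fun_add[OF vector_space_tscale3 tens3_bil(1) tens3_bil(1)]
       lift2_fun_scale[OF vector_space_tscale3 tens3_bil(1)])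
  have TC: "?\<beta> a b \<in> TC" if "a \<in> V" "b \<in> V" for a b
    by (rule lift2_closed[OF vector_space_tscale3 tens3_bil(1) subspace_TC])
       (auto simp: that linear_onD[OF \<Delta>])
  show "comul_id s V \<Delta> t \<in> TC" unfolding comul_id_def
    by (rule lift2_closed[OF vector_space_tscale3 bil subspace_TC TC t])
  show "pr3 f g h (comul_id s V \<Delta> t) = pr (dm f g) h t" if fgh: "f \<in> V'" "g \<in> V'" "h
    \<in> V'"
  proof -
    have "pr3 f g h (?\<beta> a b) = dm f g a * h b" if "a \<in> V" "b \<in> V" for a b
    proof -
      have "pr3 f g h (?\<beta> a b) = tensor_lift2 s V (\<lambda>x y. pr3 f g h (tens3 s x y b))
        (\<Delta> a)"
        by (rule lift2_compose[OF vector_space_tscale3 tens3_bil(1) subspace_TC _ _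
          vector_space_mult pr3_linear])
           (auto simp: that fgh linear_onD[OF \<Delta>])
      also have "\<dots> = tensor_lift2 s V (\<lambda>x y. h b * (f x * g y)) (\<Delta> a)"
        by (rule tensor_lift2_cong) (simp add: pr3_simps fgh that algebra_simps)
      also have "\<dots> = h b * tensor_lift2 s V (\<lambda>x y. f x * g y) (\<Delta> a)"
        by (rule lift2_fun_scale[OF vector_space_mult pr_bil]) (auto simp: that fgh linear_onD[OF
          \<Delta>])
      finally show ?thesis using that by (simp add: dm_apply pair2_def)
    qed
    then have "tensor_lift2 s V (\<lambda>a b. pr3 f g h (?\<beta> a b)) t = pr (dm f g) h t"
      unfolding pair2_def[of s V "dm f g"] by (intro tensor_lift2_cong)
    moreover have "pr3 f g h (comul_id s V \<Delta> t) = tensor_lift2 s V (\<lambda>a b. pr3 f g h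
      (?\<beta> a b)) t"
      unfolding comul_id_def
      by (rule lift2_compose[OF vector_space_tscale3 bil subspace_TC TC t vector_space_mult
        pr3_linear[OF fgh]])
    ultimately show ?thesis by simp
  qed
qed

lemma id_comul_TC:
  assumes t: "t \<in> TS"
  shows id_comul_closed: "id_comul s V \<Delta> t \<in> TC"
    and pr3_id_comul: "f \<in> V' \<Longrightarrow> g \<in> V' \<Longrightarrow> h \<in> V'
      \<Longrightarrow> pr3 f g h (id_comul s V \<Delta> t) = pr f (dm g h) t"
proof -
  let ?\<beta> = "\<lambda>a b. tensor_lift2 s V (\<lambda>x y. tens3 s a x y) (\<Delta> b)"
  have bil: "bilinear_on s tscale3 V UNIV ?\<beta>"
    by (rule bilinear_onI) (auto simp: linear_onD[OF \<Delta>] lift2_add[OF vector_space_tscale3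
      tens3_bil(2)]
       lift2_scale[OF vector_space_tscale3 tens3_bil(2)]
       lift2_fun_add[OF vector_space_tscale3 tens3_bil(2) tens3_bil(2)]
       lift2_fun_scale[OF vector_space_tscale3 tens3_bil(2)])
  have TC: "?\<beta> a b \<in> TC" if "a \<in> V" "b \<in> V" for a b
    by (rule lift2_closed[OF vector_space_tscale3 tens3_bil(2) subspace_TC])
       (auto simp: that linear_onD[OF \<Delta>])
  show "id_comul s V \<Delta> t \<in> TC" unfolding id_comul_def
    by (rule lift2_closed[OF vector_space_tscale3 bil subspace_TC TC t])
  show "pr3 f g h (id_comul s V \<Delta> t) = pr f (dm g h) t" if fgh: "f \<in> V'" "g \<in> V'" "h
    \<in> V'"
  proof -
    have "pr3 f g h (?\<beta> a b) = f a * dm g h b" if "a \<in> V" "b \<in> V" for a b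
    proof -
      have "pr3 f g h (?\<beta> a b) = tensor_lift2 s V (\<lambda>x y. pr3 f g h (tens3 s a x y))
        (\<Delta> b)"
        by (rule lift2_compose[OF vector_space_tscale3 tens3_bil(2) subspace_TC _ _
          vector_space_mult pr3_linear])
           (auto simp: that fgh linear_onD[OF \<Delta>])
      also have "\<dots> = tensor_lift2 s V (\<lambda>x y. f a * (g x * h y)) (\<Delta> b)"
        by (rule tensor_lift2_cong) (simp add: pr3_simps fgh that algebra_simps)
      also have "\<dots> = f a * tensor_lift2 s V (\<lambda>x y. g x * h y) (\<Delta> b)"
        by (rule lift2_fun_scale[OF vector_space_mult pr_bil]) (auto simp: that fgh linear_onD[OF
          \<Delta>])
      finally show ?thesis using that by (simp add: dm_apply pair2_def)
    qed
    then have "tensor_lift2 s V (\<lambda>a b. pr3 f g h (?\<beta> a b)) t = pr f (dm g h) t"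
      unfolding pair2_def[of s V f] by (intro tensor_lift2_cong)
    moreover have "pr3 f g h (id_comul s V \<Delta> t) = tensor_lift2 s V (\<lambda>a b. pr3 f g h
      (?\<beta> a b)) t"
      unfolding id_comul_def
      by (rule lift2_compose[OF vector_space_tscale3 bil subspace_TC TC t vector_space_mult
        pr3_linear[OF fgh]])
    ultimately show ?thesis by simp
  qed
qed

lemma TS_eq_iff: "t \<in> TS \<Longrightarrow> u \<in> TS \<Longrightarrow> t = u
  \<longleftrightarrow> (\<forall>f\<in>V'. \<forall>g\<in>V'. pr f g t = pr f g u)"
  using TS_eqI by blast

lemma TC_eq_iff: "t \<in> TC \<Longrightarrow> u \<in> TC \<Longrightarrow> t = u
  \<longleftrightarrow> (\<forall>f\<in>V'. \<forall>g\<in>V'. \<forall>h\<in>V'. pr3 f g h t = pr3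
  f g h u)"
  using TC_eqI by blast

lemma dual_eq_iff: "f \<in> V' \<Longrightarrow> g \<in> V' \<Longrightarrow> f = g
  \<longleftrightarrow> (\<forall>x\<in>V. f x = g x)"
  using dual_space_eqI by blast

text \<open>Used in both directions: it supplies the perm laws of the dual product of the given
  bialgebra, and it turns the coalgebra laws of the new coproduct into identities between
  products.\<close>

lemma perm_coalgebra_iff:
  "perm_coalgebra s V \<Delta> \<longleftrightarrow> (\<forall>f\<in>V'. \<forall>g\<in>V'.
    \<forall>h\<in>V'.
      dm (dm f g) h = dm f (dm g h) \<and> dm f (dm g h) = dm (dm g f) h)"
proof -
  have "comul_id s V \<Delta> (\<Delta> a) = id_comul s V \<Delta> (\<Delta> a)
    \<longleftrightarrow>
     (\<forall>f\<in>V'. \<forall>g\<in>V'. \<forall>h\<in>V'. dm (dm f g) h a = dm f (dm g h) a)"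
    "id_comul s V \<Delta> (\<Delta> a) = tflip_id s V (comul_id s V \<Delta> (\<Delta> a))
      \<longleftrightarrow>
     (\<forall>f\<in>V'. \<forall>g\<in>V'. \<forall>h\<in>V'. dm f (dm g h) a = dm (dm g f) h a)"
       if "a \<in> V" for a
    using that linear_onD(1)[OF \<Delta> that]
    by (simp_all add: TC_eq_iff comul_id_closed id_comul_closed tflip_id_closed
      pr3_comul_id pr3_id_comul pr3_tflip_id dm_apply)
  then show ?thesis unfolding perm_coalgebra_def using fd \<Delta>
    by (auto simp: dual_eq_iff)
qed

text \<open>Each condition is paired with \<open>f\<close> and \<open>g\<close>. A map on one leg
  becomes a transpose on the matching functional, and the flip exchanges the functionals, whence the
  order of \<open>g\<close> and \<open>f\<close> in the second equation.\<close>

lemma perm_bialgebra_iff: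
  assumes m: "perm_algebra s V m"
  shows "perm_bialgebra s V m \<Delta> \<longleftrightarrow> perm_coalgebra s V \<Delta> \<and>
    (\<forall>a\<in>V. \<forall>b\<in>V. \<forall>f\<in>V'. \<forall>g\<in>V'.
      dm f g (m a b) = dm (transpose_map V (ad_op m a) f) g b + dm f (transpose_map V (Rop m b) g)
        a \<and>
      dm (transpose_map V (Rop m b) g) f a = dm (transpose_map V (Rop m a) f) g b \<and>
      dm f g (m a b) = dm f (transpose_map V (Lop m a) g) b
        + (dm (transpose_map V (ad_op m b) f) g a - dm g (transpose_map V (ad_op m b) f) a))"
proof -
  have bil: "bilinear_on s s V V m" using m by (simp add: perm_algebra_def)
  note M = bilinear_onD[OF bil]
  have lin: "linear_on s s V V (Lop m a)" "linear_on s s V V (Rop m a)" "linear_on s s V V (ad_op m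
    a)"
    if "a \<in> V" for a
    using that by (auto intro!: linear_onI simp: ad_op_def Lop_def Rop_def M algebra_simps)
  have D: "\<Delta> a \<in> TS" if "a \<in> V" for a using that by (rule linear_onD(1)[OF \<Delta>])
  have E: "(\<Delta> (m a b) = tmap s V (ad_op m a) id (\<Delta> b) + tmap s V id (Rop m b)
    (\<Delta> a)) \<longleftrightarrow>
     (\<forall>f\<in>V'. \<forall>g\<in>V'. dm f g (m a b) = dm (transpose_map V (ad_op m a) f) g b
       + dm f (transpose_map V (Rop m b) g) a)"
    "(tflip s V (tmap s V (Rop m b) id (\<Delta> a)) = tmap s V (Rop m a) id (\<Delta> b))
      \<longleftrightarrow>
     (\<forall>f\<in>V'. \<forall>g\<in>V'. dm (transpose_map V (Rop m b) g) f a = dm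
       (transpose_map V (Rop m a) f) g b)"
    "(\<Delta> (m a b) = tmap s V id (Lop m a) (\<Delta> b) + tmap s V (ad_op m b) id (\<Delta> a -
      tflip s V (\<Delta> a))) \<longleftrightarrow>
     (\<forall>f\<in>V'. \<forall>g\<in>V'. dm f g (m a b) = dm f (transpose_map V (Lop m a) g) b
        + (dm (transpose_map V (ad_op m b) f) g a - dm g (transpose_map V (ad_op m b) f) a))"
    if "a \<in> V" "b \<in> V" for a b
    using that
    by (simp_all add: TS_eq_iff D M lin linear_on_id tmap_closed tflip_closed pr_tmap pr_tflip
      pr_simps
       transpose_map_id dm_apply)
  show ?thesis using m unfolding perm_bialgebra_def ball_conj_distrib
    by (simp only: E cong: ball_cong) simp
qed

end

end

section \<open>Manin triples of perm algebras\<close>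

text \<open>The form makes the two projections adjoint to each other, and each of them projects to a
  subalgebra. The families \<open>p\<close> and \<open>q\<close> enter through their contractions
  with the form, \<open>- Q\<close> and \<open>P\<close>; the sign arises because, in the double, a
  basis vector of \<open>A\<close> pairs with \<open>u\<close> to minus the value of the functional
  part of \<open>u\<close>.\<close>

locale manin = fd_vs s V for s :: "'k::field_char_0 \<Rightarrow> 'v::ab_group_add \<Rightarrow>
  'v" and V :: "'v set" +
  fixes M :: "'v \<Rightarrow> 'v \<Rightarrow> 'v" and B :: "'v \<Rightarrow> 'v \<Rightarrow> 'k"
    and P Q :: "'v \<Rightarrow> 'v"
    and n :: nat and p q :: "nat \<Rightarrow> 'v"
  assumes perm: "perm_algebra s V M"
    and B_bil: "bilinear_on s (*) V UNIV B"
    and skew: "x \<in> V \<Longrightarrow> y \<in> V \<Longrightarrow> B x y = - B y x"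
    and nondeg: "x \<in> V \<Longrightarrow> (\<And>y. y \<in> V \<Longrightarrow> B x y = 0)
      \<Longrightarrow> x = 0"
    and repr: "f \<in> dual_space s V \<Longrightarrow> \<exists>u\<in>V. \<forall>x\<in>V. f x = B
      u x"
    and inv1: "x \<in> V \<Longrightarrow> y \<in> V \<Longrightarrow> z \<in> V \<Longrightarrow>
      B (M x y) z = B x (M y z - M z y)"
    and Q_lin: "linear_on s s V V Q"
    and P_closed [simp]: "x \<in> V \<Longrightarrow> P x \<in> V"
    and PQ: "x \<in> V \<Longrightarrow> P x + Q x = x"
    and QP: "x \<in> V \<Longrightarrow> y \<in> V \<Longrightarrow> B (Q x) y = B x (P y)"
    and P_sub: "x \<in> V \<Longrightarrow> y \<in> V \<Longrightarrow> Q (M (P x) (P y)) = 0"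
    and Q_sub: "x \<in> V \<Longrightarrow> y \<in> V \<Longrightarrow> P (M (Q x) (Q y)) = 0"
    and pq_closed [simp]: "i \<in> {1..n} \<Longrightarrow> p i \<in> V" "i \<in> {1..n}
      \<Longrightarrow> q i \<in> V"
    and sum_q: "u \<in> V \<Longrightarrow> (\<Sum>i=1..n. s (B u (p i)) (q i)) = - Q u"
    and sum_p: "u \<in> V \<Longrightarrow> (\<Sum>i=1..n. s (B u (q i)) (p i)) = P u"
begin

definition "r = (\<Sum>i=1..n. tens2 s (p i) (q i))"
text \<open>The identification of \<open>V\<close> with its dual by the form, cut off outside
  \<open>V\<close> to lie in \<open>dual_space\<close>. It is bijective by \<open>hat_exists\<close>
  and \<open>hat_eq_iff\<close>.\<close>

definition "hat u = (\<lambda>x. if x \<in> V then B u x else 0)"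

lemma M_bil: "bilinear_on s s V V M" using perm by (simp add: perm_algebra_def)
lemmas M_simps = bilinear_onD[OF M_bil]
lemmas B_simps = bilinear_onD(2-)[OF B_bil]
lemmas Q_simps = linear_onD[OF Q_lin]
declare M_simps(1) [simp] Q_simps(1) [simp]

lemma assoc: "a \<in> V \<Longrightarrow> b \<in> V \<Longrightarrow> c \<in> V \<Longrightarrow> M
  a (M b c) = M (M a b) c"
  and left_comm: "a \<in> V \<Longrightarrow> b \<in> V \<Longrightarrow> c \<in> V
    \<Longrightarrow> M (M a b) c = M (M b a) c"
  using perm by (auto simp: perm_algebra_def)

lemma hat_closed [simp]: "u \<in> V \<Longrightarrow> hat u \<in> V'"
  by (auto simp: hat_def dual_space_def B_simps intro!: linear_onI)

lemma hat_apply: "x \<in> V \<Longrightarrow> hat u x = B u x" by (simp add: hat_def)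

lemma hat_exists: assumes "f \<in> V'" obtains u where "u \<in> V" "f = hat u"
proof -
  obtain u where u: "u \<in> V" "\<forall>x\<in>V. f x = B u x" using repr[OF assms] by blast
  have "f = hat u" by (rule dual_space_eqI[OF assms]) (use u in \<open>auto simp: hat_apply\<close>)
  then show thesis using that u by blast
qed

lemma ball_dual: "(\<forall>f\<in>V'. R f) \<longleftrightarrow> (\<forall>u\<in>V. R (hat u))"
  using hat_exists hat_closed by metis

lemma B_zero: "x \<in> V \<Longrightarrow> B 0 x = 0" "x \<in> V \<Longrightarrow> B x 0 = 0"
  using B_simps(2)[of 0 x 0] B_simps(4)[of x 0 0] by auto

lemma B_minus: "x \<in> V \<Longrightarrow> y \<in> V \<Longrightarrow> B (- x) y = - B x y" "x
  \<in> V \<Longrightarrow> y \<in> V \<Longrightarrow> B x (- y) = - B x y"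
  using B_simps(2)[of x y "-1"] B_simps(4)[of x y "-1"] by auto

lemma B_diff: "x \<in> V \<Longrightarrow> y \<in> V \<Longrightarrow> z \<in> V \<Longrightarrow>
  B (x - y) z = B x z - B y z"
  "x \<in> V \<Longrightarrow> y \<in> V \<Longrightarrow> z \<in> V \<Longrightarrow> B x (y - z)
    = B x y - B x z"
  using B_simps(1)[of x "- y" z] B_simps(3)[of x y "- z"] by (auto simp: B_minus)

lemmas B_lin = B_zero B_minus B_diff B_simps

lemma M_zero: "x \<in> V \<Longrightarrow> M 0 x = 0" "x \<in> V \<Longrightarrow> M x 0 = 0"
  using M_simps(3)[of 0 x 0] M_simps(5)[of x 0 0] by auto

lemma M_minus: "x \<in> V \<Longrightarrow> y \<in> V \<Longrightarrow> M (- x) y = - M x y" "x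
  \<in> V \<Longrightarrow> y \<in> V \<Longrightarrow> M x (- y) = - M x y"
  using M_simps(3)[of x y "-1"] M_simps(5)[of x y "-1"] by auto

lemma M_diff: "x \<in> V \<Longrightarrow> y \<in> V \<Longrightarrow> z \<in> V \<Longrightarrow>
  M (x - y) z = M x z - M y z"
  "x \<in> V \<Longrightarrow> y \<in> V \<Longrightarrow> z \<in> V \<Longrightarrow> M x (y - z)
    = M x y - M x z"
  using M_simps(2)[of x "- y" z] M_simps(4)[of x y "- z"] by (auto simp: M_minus)

lemmas M_lin = M_zero M_minus M_diff M_simps(2-)

lemma Q_diff: "x \<in> V \<Longrightarrow> y \<in> V \<Longrightarrow> Q (x - y) = Q x - Q y"
  using Q_simps(2)[of x "- y"] Q_simps(3)[of y "-1"] by auto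

lemma P_eq: "x \<in> V \<Longrightarrow> P x = x - Q x" using PQ[of x] by (simp add: algebra_simps)

text \<open>\<open>inv1\<close> makes \<open>B (M x y) z\<close> antisymmetric in \<open>y\<close>
  and \<open>z\<close>; with skewness this says that left multiplication is self-adjoint.\<close>

lemma inv2: "x \<in> V \<Longrightarrow> y \<in> V \<Longrightarrow> z \<in> V \<Longrightarrow> B
  (M x y) z = B y (M x z)"
proof -
  assume a: "x \<in> V" "y \<in> V" "z \<in> V"
  have "B (M x y) z = - B (M x z) y" using a by (simp add: inv1 B_diff)
  then show ?thesis using a skew[of "M x z" y] by simp
qed

lemma B_eqI:
  assumes "x \<in> V" "y \<in> V" "\<And>z. z \<in> V \<Longrightarrow> B x z = B y z"
  shows "x = y"
  using nondeg[of "x - y"] assms by (simp add: B_lin)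

lemma hat_eq_iff: "u \<in> V \<Longrightarrow> v \<in> V \<Longrightarrow> hat u = hat v
  \<longleftrightarrow> u = v"
  using B_eqI hat_apply by metis

text \<open>The \<open>P\<close> component of the product vanishes by \<open>Q_sub\<close>, so
  \<open>Q\<close> fixes it.\<close>

lemma QQ: "x \<in> V \<Longrightarrow> y \<in> V \<Longrightarrow> Q (M (Q x) (Q y)) = M (Q x) (Q
  y)"
  using PQ[of "M (Q x) (Q y)"] by (simp add: Q_sub)

lemma lin_ops: assumes "a \<in> V"
  shows "linear_on s s V V (Lop M a)" "linear_on s s V V (Rop M a)" "linear_on s s V V (ad_op M a)"
  using assms by (auto intro!: linear_onI simp: ad_op_def Lop_def Rop_def M_simps algebra_simps)

text \<open>Under \<open>hat\<close>, transposes become operations of the algebra itself. For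
  \<open>Rop\<close>, \<open>inv1\<close> gives \<open>B(u, yx) = B(u, xy) - B(ux, y)\<close>, and
  \<open>inv2\<close> moves \<open>x\<close> in the first term.\<close>

lemma transpose_hat:
  assumes "x \<in> V" "u \<in> V"
  shows "transpose_map V (Rop M x) (hat u) = hat (M x u - M u x)"
    "transpose_map V (ad_op M x) (hat u) = hat (M u x)"
    "transpose_map V (Lop M x) (hat u) = hat (M x u)"
proof -
  have "B u (M y x) = B (M x u - M u x) y" if "y \<in> V" for y
    using that assms inv1[of u x y] inv2[of x u y] by (simp add: B_lin)
  then show "transpose_map V (Rop M x) (hat u) = hat (M x u - M u x)"
    using assms by (auto simp: transpose_map_def hat_def Rop_def fun_eq_iff)
  show "transpose_map V (ad_op M x) (hat u) = hat (M u x)"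
    using assms by (auto simp: transpose_map_def hat_def ad_op_def Lop_def Rop_def fun_eq_iff inv1)
  show "transpose_map V (Lop M x) (hat u) = hat (M x u)"
    using assms by (auto simp: transpose_map_def hat_def Lop_def fun_eq_iff inv2)
qed

section \<open>The tensor of the dual families and its coproduct\<close>

lemma r_TS: "r \<in> TS" unfolding r_def by (rule TS_sum) simp

text \<open>Stated for an arbitrary bilinear form because the Yang-Baxter equation needs it for
  \<open>B x (M a b)\<close> and \<open>B x (M b a)\<close>: read from right to left, it collapses a
  double sum into one value.\<close>

lemma bil_sum:
  assumes \<phi>: "bilinear_on s (*) V UNIV \<phi>" and "finite I" "finite J"
    and x: "\<And>i. i \<in> I \<Longrightarrow> x i \<in> V" and y: "\<And>j. j \<in> J
      \<Longrightarrow> y j \<in> V"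
  shows "\<phi> (\<Sum>i\<in>I. s (c i) (x i)) (\<Sum>j\<in>J. s (d j) (y j)) = (\<Sum>i\<in>I.
    \<Sum>j\<in>J. c i * d j * \<phi> (x i) (y j))"
proof -
  note F = bilinear_onD[OF \<phi>]
  have z: "\<phi> 0 v = 0" "\<phi> v 0 = 0" if "v \<in> V" for v
    using F(3)[of 0 v 0] F(5)[of v 0 0] that by auto
  have sV: "(\<Sum>j\<in>K. s (d j) (y j)) \<in> V" if "K \<subseteq> J" for K
    by (rule subspace_sum[OF sub_V]) (use that y in auto)
  have sV': "(\<Sum>j\<in>K. s (c j) (x j)) \<in> V" if "K \<subseteq> I" for K
    by (rule subspace_sum[OF sub_V]) (use that x in auto)
  have 1: "\<phi> v (\<Sum>j\<in>J. s (d j) (y j)) = (\<Sum>j\<in>J. d j * \<phi> v (y j))" if "v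
    \<in> V" for v
  proof -
    have "K \<subseteq> J \<Longrightarrow> \<phi> v (\<Sum>j\<in>K. s (d j) (y j)) =
      (\<Sum>j\<in>K. d j * \<phi> v (y j))" if "finite K" for K
      using that by (induction K) (simp_all add: z \<open>v \<in> V\<close> F sV y)
    then show ?thesis using assms by blast
  qed
  have "K \<subseteq> I \<Longrightarrow> \<phi> (\<Sum>i\<in>K. s (c i) (x i)) v = (\<Sum>i\<in>K.
    c i * \<phi> (x i) v)" if "finite K" "v \<in> V" for K v
    using that by (induction K) (simp_all add: z F sV' x)
  from this[OF assms(2) sV] have "\<phi> (\<Sum>i\<in>I. s (c i) (x i)) (\<Sum>j\<in>J. s (d j) (y
    j))
     = (\<Sum>i\<in>I. c i * \<phi> (x i) (\<Sum>j\<in>J. s (d j) (y j)))" by simp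
  also have "\<dots> = (\<Sum>i\<in>I. \<Sum>j\<in>J. c i * d j * \<phi> (x i) (y j))"
    by (intro sum.cong refl) (simp add: 1 x sum_distrib_left mult.assoc)
  finally show ?thesis .
qed

text \<open>The first functional contracts the first leg to \<open>- Q u\<close>, and skewness of
  the remaining form absorbs the sign.\<close>

lemma pr_r: assumes "u \<in> V" "v \<in> V" shows "pr (hat u) (hat v) r = B (Q u) v"
proof -
  have "pr (hat u) (hat v) r = (\<Sum>i=1..n. B u (p i) * B v (q i))"
    unfolding r_def pair2_def
    by (subst lift2_sum_family[OF vector_space_mult pr_bil]) (auto simp: assms hat_apply intro!:
      sum.cong)
  \<comment> \<open>The index set \<open>{0}\<close> with coefficient 1 presents \<open>v\<close> as
    a one-term sum, so only the second argument is expanded.\<close>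
  also have "\<dots> = B v (\<Sum>i=1..n. s (B u (p i)) (q i))"
    using bil_sum[OF B_bil, of "{0::nat}" "{1..n}" "\<lambda>_. v" q "\<lambda>_. 1" "\<lambda>i. B
      u (p i)"] assms by simp
  also have "\<dots> = B (Q u) v" using assms sum_q[of u] skew[of v "Q u"] by (simp add: B_lin)
  finally show ?thesis .
qed

abbreviation "\<Delta> \<equiv> coboundary s V M r"
abbreviation "r' \<equiv> r - tflip s V r"

lemma r'_TS: "r' \<in> TS" by (simp add: r_TS tflip_closed)

text \<open>Adjointness turns \<open>B (Q u) v\<close> into \<open>B u (P v)\<close>, and skewness
  turns the flipped term \<open>- B (Q v) u\<close> into \<open>B u (Q v)\<close>; the two parts of
  \<open>v\<close> recombine.\<close>

lemma pr_r': assumes "u \<in> V" "v \<in> V" shows "pr (hat u) (hat v) r' = B u v"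
  using assms PQ[of v] skew[of "Q v" u] B_simps(3)[of u "P v" "Q v"]
  by (simp add: pr_simps r_TS tflip_closed pr_tflip pr_r QP)

lemma cob_TS: "x \<in> V \<Longrightarrow> t \<in> TS \<Longrightarrow> coboundary s V M t x \<in>
  TS"
  unfolding coboundary_def by (auto intro!: TS_diff tmap_closed lin_ops linear_on_id)

lemma pr_cob:
  assumes "x \<in> V" "t \<in> TS" "u \<in> V" "v \<in> V"
  shows "pr (hat u) (hat v) (coboundary s V M t x)
    = pr (hat u) (hat (M x v - M v x)) t - pr (hat (M u x)) (hat v) t"
  using assms unfolding coboundary_def
  by (simp add: pr_simps tmap_closed lin_ops linear_on_id pr_tmap transpose_map_id[of _ s]
    transpose_hat)

lemma pr_\<Delta>: assumes "x \<in> V" "u \<in> V" "v \<in> V"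
  shows "pr (hat u) (hat v) (\<Delta> x) = B (M (Q u) x - Q (M u x)) v"
  using assms by (simp add: pr_cob r_TS pr_r inv1 B_diff(1))

lemma TS_eqI_hat:
  assumes "t \<in> TS" "t' \<in> TS" "\<And>u v. u \<in> V \<Longrightarrow> v \<in> V
    \<Longrightarrow> pr (hat u) (hat v) t = pr (hat u) (hat v) t'"
  shows "t = t'"
  by (rule TS_eqI[OF assms(1,2)]) (metis assms(3) hat_exists)

lemma \<Delta>_lin: "linear_on s tscale2 V TS \<Delta>"
proof (rule linear_onI)
  show "\<Delta> (x + y) = \<Delta> x + \<Delta> y" if "x \<in> V" "y \<in> V" for x y
    by (rule TS_eqI_hat) (use that in \<open>simp_all add: cob_TS r_TS pr_\<Delta> pr_simps M_lin
      B_lin Q_simps algebra_simps\<close>)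
  show "\<Delta> (s c x) = tscale2 c (\<Delta> x)" if "x \<in> V" for x c
    by (rule TS_eqI_hat) (use that in \<open>simp_all add: cob_TS r_TS pr_\<Delta> pr_simps M_lin
      B_lin Q_simps algebra_simps\<close>)
qed (simp add: cob_TS r_TS)

lemma dm_hat_apply: assumes "x \<in> V" "u \<in> V" "v \<in> V"
  shows "dual_mult s V \<Delta> (hat u) (hat v) x = B (M (Q u) x - Q (M u x)) v"
  using assms by (simp add: dm_apply[OF \<Delta>_lin] pr_\<Delta>)

text \<open>Adjointness and \<open>inv2\<close> bring the value to
  \<open>B(x, (Qu)v - u(Pv))\<close>. Splitting \<open>v\<close> in the first product and
  \<open>u\<close> in the second yields the mixed term \<open>(Qu)(Pv)\<close> twice with opposite
  signs, so only pure products survive; skewness gives the final sign.\<close>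

lemma dm_hat: assumes "u \<in> V" "v \<in> V"
  shows "dual_mult s V \<Delta> (hat u) (hat v) = hat (M (P u) (P v) - M (Q u) (Q v))"
proof (rule dual_space_eqI)
  fix x assume x: "x \<in> V"
  have "B (M (Q u) x - Q (M u x)) v = B (M (Q u) x) v - B (M u x) (P v)"
    using assms x by (simp add: B_lin QP)
  also have "\<dots> = B x (M (Q u) v - M u (P v))"
    using assms x by (simp add: B_lin inv2)
  also have "M (Q u) v - M u (P v) = M (Q u) (P v + Q v) - M (P u + Q u) (P v)"
    using assms by (simp add: PQ)
  also have "\<dots> = M (Q u) (Q v) - M (P u) (P v)" using assms by (simp add: M_lin)
  also have "B x \<dots> = B (M (P u) (P v) - M (Q u) (Q v)) x"
    using assms x skew[of x "M (P u) (P v)"] skew[of x "M (Q u) (Q v)"] by (simp add: B_lin)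
  finally show "dual_mult s V \<Delta> (hat u) (hat v) x = hat (M (P u) (P v) - M (Q u) (Q v)) x"
    using assms x by (simp add: dm_hat_apply hat_apply)
qed (use assms in \<open>auto intro: dm_closed[OF \<Delta>_lin]\<close>)

text \<open>The two components of the dual product do not mix, and the sign of the \<open>Q\<close>
  component occurs twice in an iterated product. Every bracketing is thus a triple product of
  \<open>P\<close> parts plus one of \<open>Q\<close> parts, and the perm laws of \<open>M\<close>
  apply to each.\<close>

lemma coalgebra: "perm_coalgebra s V \<Delta>"
proof -
  have P: "P (M (P u) (P v) - M (Q u) (Q v)) = M (P u) (P v)"
    and Q: "Q (M (P u) (P v) - M (Q u) (Q v)) = - M (Q u) (Q v)" if "u \<in> V" "v \<in> V" for u v
  proof -
    show Q: "Q (M (P u) (P v) - M (Q u) (Q v)) = - M (Q u) (Q v)"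
      using that by (simp add: Q_diff P_sub QQ)
    show "P (M (P u) (P v) - M (Q u) (Q v)) = M (P u) (P v)"
      using that by (subst P_eq) (simp_all add: Q_diff P_sub QQ)
  qed
  show ?thesis unfolding perm_coalgebra_iff[OF \<Delta>_lin] ball_dual
    by (auto simp: dm_hat hat_eq_iff P Q M_lin assoc left_comm[of "P _" "P _"] left_comm[of "Q _"
      "Q _"]; metis P_closed Q_simps(1) left_comm)
qed

lemma bialgebra: "perm_bialgebra s V M \<Delta>"
proof -
  \<comment> \<open>By \<open>inv1\<close> the commutator of \<open>b\<close> and \<open>g\<close>
    becomes right multiplication by \<open>b\<close>. The terms \<open>M (Q (M f a)) b\<close> then
    cancel and associativity finishes.\<close>
  have 1: "B (M (Q f) (M a b) - Q (M f (M a b))) g =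
     B (M (Q (M f a)) b - Q (M (M f a) b)) g + B (M (Q f) a - Q (M f a)) (M b g - M g b)"
    if "a \<in> V" "b \<in> V" "f \<in> V" "g \<in> V" for a b f g
  proof -
    have "B (M (Q f) a - Q (M f a)) (M b g - M g b) = B (M (M (Q f) a - Q (M f a)) b) g"
      using that by (simp add: inv1)
    then show ?thesis using that by (simp add: M_lin B_diff(1) assoc)
  qed
  have 2: "B (M (Q (M b g - M g b)) a - Q (M (M b g - M g b) a)) f =
    B (M (Q (M a f - M f a)) b - Q (M (M a f - M f a) b)) g"
    if "a \<in> V" "b \<in> V" "f \<in> V" "g \<in> V" for a b f g
  proof -
    \<comment> \<open>In a perm algebra left multiplication by a commutator is zero. This removes
      the terms with \<open>Q\<close> outside a product, and with \<open>inv1\<close> it makes the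
      two commutators orthogonal, so that
      \<open>B(Qx, y) = B(x, Py) = -B(x, Qy) = B(Qy, x)\<close>.\<close>
    have 0: "M (M b g - M g b) a = 0" "M (M a f - M f a) b = 0"
      using that left_comm[of b g a] left_comm[of a f b] by (simp_all add: M_lin)
    have Q0: "Q 0 = 0" using Q_diff[of 0 0] by simp
    let ?x = "M b g - M g b" and ?y = "M a f - M f a"
    have "B ?x ?y = B (M ?x a) f" using that inv1[of ?x a f] by simp
    also have "\<dots> = 0" using that by (simp add: 0 B_zero)
    finally have xy: "B ?x ?y = 0" .
    have "B (M (Q ?x) a) f = B (Q ?x) ?y" using that by (simp add: inv1)
    also have "\<dots> = - B ?x (Q ?y)"
      using that xy PQ[of ?y] B_simps(3)[of ?x "P ?y" "Q ?y"] by (simp add: QP eq_neg_iff_add_eq_0)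
    also have "\<dots> = B (Q ?y) ?x" using that skew[of ?x "Q ?y"] by simp
    also have "\<dots> = B (M (Q ?y) b) g" using that by (simp add: inv1)
    finally show ?thesis using that by (simp add: 0 Q0)
  qed
  \<comment> \<open>All terms are brought to the form \<open>B _ g\<close>. The first arguments then
    agree because \<open>a(fb) = f(ab)\<close>, which holds for \<open>Q f\<close> in place of
    \<open>f\<close> as well, and because \<open>P\<close> and \<open>Q\<close> sum to the
    identity.\<close>
  have 3: "B (M (Q f) (M a b) - Q (M f (M a b))) g =
     B (M (Q f) b - Q (M f b)) (M a g)
     + (B (M (Q (M f b)) a - Q (M (M f b) a)) g - B (M (Q g) a - Q (M g a)) (M f b))"
    if "a \<in> V" "b \<in> V" "f \<in> V" "g \<in> V" for a b f g
  proof -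
    let ?w = "M f b"
    have e1: "B (M (Q f) b - Q ?w) (M a g) = B (M a (M (Q f) b) - M a (Q ?w)) g"
      using that by (simp add: inv2[symmetric] M_lin)
    have "B (M (Q g) a - Q (M g a)) ?w = B (Q g) (M a ?w - M ?w a) - B (M g a) (P ?w)"
      using that by (simp add: B_lin inv1 QP)
    also have "\<dots> = B g (P (M a ?w - M ?w a)) - B g (M a (P ?w) - M (P ?w) a)"
      using that by (simp add: QP inv1)
    also have "\<dots> = B (M a (P ?w) - M (P ?w) a - P (M a ?w - M ?w a)) g"
      using that skew[of g "P (M a ?w - M ?w a)"] skew[of g "M a (P ?w) - M (P ?w) a"] by (simp
        add: B_diff(1))
    finally have e2: "B (M (Q g) a - Q (M g a)) ?w = B (M a (P ?w) - M (P ?w) a - P (M a ?w - M ?w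
      a)) g" .
    have "M a ?w = M f (M a b)" using that by (simp add: assoc left_comm[of f a])
    moreover have "M a (M (Q f) b) = M (Q f) (M a b)" using that by (simp add: assoc left_comm[of
      "Q f" a])
    ultimately have "M (Q f) (M a b) - Q (M f (M a b)) =
       M a (M (Q f) b) - M a (Q ?w) + (M (Q ?w) a - Q (M ?w a)
        - (M a (P ?w) - M (P ?w) a - P (M a ?w - M ?w a)))"
      using that by (simp add: P_eq Q_diff M_lin algebra_simps)
    then show ?thesis using that unfolding e1 e2 by (simp add: B_simps(1)[symmetric]
      B_diff(1)[symmetric])
  qed
  show ?thesis unfolding perm_bialgebra_iff[OF \<Delta>_lin perm]
    using coalgebra by (simp add: ball_dual transpose_hat dm_hat_apply 1[symmetric] 3[symmetric] 2)
qed

text \<open>After contraction the commutator term \<open>B(u, (Pv)(Pw) - (Pw)(Pv))\<close> equals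
  \<open>B(Pv, (Qu)(Pw))\<close>, and \<open>- B(w, (Qu)(Qv))\<close> equals
  \<open>B(Qv, (Qu)(Pw))\<close>. Together they cancel the remaining term
  \<open>- B(v, (Qu)(Pw))\<close>.\<close>

lemma YBE: "perm_YBE s V M r"
proof -
  interpret t3: vector_space "tscale3 :: 'k \<Rightarrow> ('v, 'k) tensor3 \<Rightarrow> _" by
    (rule vector_space_tscale3)
  \<comment> \<open>The summand as a function of the entries of two elementary tensors. It is
    bilinear in the inner pair, and its sum over \<open>j\<close> is bilinear in the outer pair, so
    both lifts can be evaluated on \<open>r\<close>.\<close>
  define E where "E = (\<lambda>a b a' b'. tens3 s a (M b a') b' - tens3 s a a' (M b b')
         + tens3 s (M a a') b b' - tens3 s (M a' a) b b')"
  have E_TC: "E a b a' b' \<in> TC" if "a \<in> V" "b \<in> V" "a' \<in> V" "b' \<in> V" for a b a'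
    b'
    using that by (simp add: E_def)
  have E1: "bilinear_on s tscale3 V UNIV (E a b)" if "a \<in> V" "b \<in> V" for a b
    by (rule bilinear_onI) (use that in \<open>simp_all add: E_def M_lin
      t3.scale_right_diff_distrib t3.scale_right_distrib algebra_simps\<close>)
  have E2: "bilinear_on s tscale3 V UNIV (\<lambda>a b. \<Sum>j=1..n. E a b (p j) (q j))"
    by (rule bilinear_onI) (simp_all add: E_def M_lin sum.distrib sum_subtractf t3.scale_sum_right
       t3.scale_right_diff_distrib t3.scale_right_distrib algebra_simps)
  have "tensor_lift2 s V (\<lambda>a b. tensor_lift2 s V (E a b) r) r
     = tensor_lift2 s V (\<lambda>a b. \<Sum>j=1..n. E a b (p j) (q j)) r"
    unfolding r_def by (rule tensor_lift2_cong) (rule lift2_sum_family[OF vector_space_tscale3 E1],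
      auto)
  also have "\<dots> = (\<Sum>i=1..n. \<Sum>j=1..n. E (p i) (q i) (p j) (q j))"
    unfolding r_def by (rule lift2_sum_family[OF vector_space_tscale3 E2]) auto
  also have "\<dots> = 0"
  proof (rule TC_eqI)
    have TC_sum: "(\<Sum>i\<in>I. F i) \<in> TC" if "\<And>i. i \<in> I \<Longrightarrow> F i \<in>
      TC" for F and I :: "nat set"
      using that by (induction I rule: infinite_finite_induct) auto
    show "(\<Sum>i=1..n. \<Sum>j=1..n. E (p i) (q i) (p j) (q j)) \<in> TC"
      by (intro TC_sum E_TC) auto
    fix f g h assume "f \<in> V'" "g \<in> V'" "h \<in> V'"
    then obtain u v w where uvw: "u \<in> V" "v \<in> V" "w \<in> V" "f = hat u" "g = hat v" "h =
      hat w"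
      by (metis hat_exists)
    note fgh = \<open>f \<in> V'\<close> \<open>g \<in> V'\<close> \<open>h \<in> V'\<close>
    have pr3_sum: "pr3 f g h (\<Sum>i\<in>I. F i) = (\<Sum>i\<in>I. pr3 f g h (F i))"
      if "\<And>i. i \<in> I \<Longrightarrow> F i \<in> TC" for F and I :: "nat set"
      using that by (induction I rule: infinite_finite_induct) (auto simp: pr3_simps fgh TC_sum)
    have E: "pr3 f g h (E a b a' b') = B u a * B w b' * B v (M b a') - B u a * B v a' * B w (M b b')
        + B v b * B w b' * B u (M a a') - B v b * B w b' * B u (M a' a)"
      if "a \<in> V" "b \<in> V" "a' \<in> V" "b' \<in> V" for a b a' b'
      using that fgh by (simp add: E_def pr3_simps pr3_diff) (simp add: uvw hat_apply algebra_simps)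
    have bil: "bilinear_on s (*) V UNIV (\<lambda>a b. B x (M a b))" if "x \<in> V" for x
      by (rule bilinear_onI) (use that in \<open>simp_all add: M_lin B_lin\<close>)
    have bil': "bilinear_on s (*) V UNIV (\<lambda>a b. B x (M b a))" if "x \<in> V" for x
      by (rule bilinear_onI) (use that in \<open>simp_all add: M_lin B_lin\<close>)
    have "pr3 f g h (\<Sum>i=1..n. \<Sum>j=1..n. E (p i) (q i) (p j) (q j))
      = (\<Sum>i=1..n. \<Sum>j=1..n. pr3 f g h (E (p i) (q i) (p j) (q j)))"
      by (subst pr3_sum, (intro TC_sum E_TC; simp), intro sum.cong refl pr3_sum E_TC) auto
    also have "\<dots> = (\<Sum>i=1..n. \<Sum>j=1..n. B u (p i) * B w (q j) * B v (M (q i) (p j)))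
       - (\<Sum>i=1..n. \<Sum>j=1..n. B u (p i) * B v (p j) * B w (M (q i) (q j)))
       + (\<Sum>i=1..n. \<Sum>j=1..n. B v (q i) * B w (q j) * B u (M (p i) (p j)))
       - (\<Sum>i=1..n. \<Sum>j=1..n. B v (q i) * B w (q j) * B u (M (p j) (p i)))"
      by (simp add: E sum.distrib sum_subtractf)
    \<comment> \<open>Contracting a \<open>p\<close> leg with \<open>u\<close> leaves
      \<open>- Q u\<close> in place of its partner \<open>q\<close>; contracting a \<open>q\<close>
      leg leaves \<open>P\<close> in place of its partner \<open>p\<close>. The second sum has two
      contracted \<open>p\<close> legs and so two signs.\<close>
    also have "\<dots> = B v (M (- Q u) (P w)) - B w (M (- Q u) (- Q v)) + B u (M (P v) (P w)) - B
      u (M (P w) (P v))"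
      using uvw(1-3) by (simp only: bil_sum[OF bil, symmetric] bil_sum[OF bil', symmetric]
        finite_atLeastAtMost
         pq_closed sum_p sum_q)
    also have "\<dots> = 0"
    proof -
      \<comment> \<open>The commutator of two \<open>P\<close> parts has no \<open>Q\<close>
        component, so \<open>P\<close> may be inserted and moved across the form as
        \<open>Q u\<close>.\<close>
      have "B u (M (P v) (P w) - M (P w) (P v)) = B u (P (M (P v) (P w) - M (P w) (P v)))"
        using uvw(1-3) by (simp add: P_eq[of "M _ _ - M _ _"] Q_diff P_sub)
      also have "\<dots> = B (Q u) (M (P v) (P w) - M (P w) (P v))" using uvw(1-3) by (simp add: QP)
      also have "\<dots> = B (M (Q u) (P v)) (P w)" using uvw(1-3) by (simp add: inv1)
      also have "\<dots> = B (P v) (M (Q u) (P w))" using uvw(1-3) by (simp add: inv2)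
      finally have a: "B u (M (P v) (P w)) - B u (M (P w) (P v)) = B (P v) (M (Q u) (P w))"
        using uvw(1-3) by (simp add: B_lin)
      have "B (Q v) (M (Q u) (P w)) = B (M (Q u) (Q v)) (P w)" using uvw(1-3) by (simp add: inv2)
      also have "\<dots> = B (M (Q u) (Q v)) w" using uvw(1-3) by (simp add: QP[symmetric] QQ)
      finally have b: "B (Q v) (M (Q u) (P w)) = - B w (M (Q u) (Q v))"
        using uvw(1-3) skew[of w "M (Q u) (Q v)"] by simp
      have "B v (M (Q u) (P w)) = B (P v + Q v) (M (Q u) (P w))" using uvw(1-3) by (simp add: PQ)
      also have "\<dots> = B (P v) (M (Q u) (P w)) + B (Q v) (M (Q u) (P w))"
        using uvw(1-3) by (simp add: B_lin)
      finally show ?thesis using uvw(1-3) b by (simp add: M_lin B_lin a[symmetric])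
    qed
    finally show "pr3 f g h (\<Sum>i=1..n. \<Sum>j=1..n. E (p i) (q i) (p j) (q j)) = pr3 f g h 0"
      by (simp add: pr3_simps fgh)
  qed simp
  finally show ?thesis unfolding perm_YBE_def E_def .
qed

text \<open>Up to the factor one half, the pairing is \<open>B(u, xv - vx) - B(ux, v)\<close>:
  invariance of the tensor is exactly \<open>inv1\<close>.\<close>

lemma invariant: "R_ad_invariant s V M (tscale2 (1/2) r')"
  unfolding R_ad_invariant_def coboundary_def[symmetric]
proof
  fix x assume x: "x \<in> V"
  show "coboundary s V M (tscale2 (1/2) r') x = 0"
    by (rule TS_eqI_hat) (use x in \<open>simp_all add: cob_TS r'_TS pr_cob pr_simps pr_r'
      inv1\<close>)
qed

lemma T_bil: "f \<in> V' \<Longrightarrow> bilinear_on s s V UNIV (\<lambda>a b. s (f a) b)"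
  by (rule bilinear_onI) (auto simp: dual_spaceD algebra_simps)

lemma T_closed: "f \<in> V' \<Longrightarrow> t \<in> TS \<Longrightarrow> T_op s V t f \<in> V"
  unfolding T_op_def by (rule lift2_closed[OF vector_space_axioms T_bil sub_V]) auto

lemma T_linear: "t \<in> TS \<Longrightarrow> linear_on fscale s V' V (T_op s V t)"
proof (rule linear_onI)
  fix f g assume "t \<in> TS" "f \<in> V'" "g \<in> V'"
  moreover have "(\<lambda>a b. s ((f + g) a) b) = (\<lambda>a b. s (f a) b + s (g a) b)"
    by (simp add: fun_eq_iff fun_apply scale_left_distrib)
  ultimately show "T_op s V t (f + g) = T_op s V t f + T_op s V t g" unfolding T_op_def
    by (simp add: lift2_fun_add[OF vector_space_axioms T_bil T_bil])
next
  fix c f assume "t \<in> TS" "f \<in> V'"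
  then show "T_op s V t (fscale c f) = s c (T_op s V t f)" unfolding T_op_def
    by (simp add: lift2_fun_scale[OF vector_space_axioms T_bil, symmetric] fscale_def)
qed (rule T_closed)

text \<open>The contracted vector \<open>w\<close> satisfies
  \<open>B(v, w) = B(u, v) = B(v, -u)\<close> for all \<open>v\<close>, so \<open>w = -u\<close> by
  nondegeneracy.\<close>

lemma T_hat: assumes u: "u \<in> V" shows "T_op s V r' (hat u) = - u"
proof (rule B_eqI)
  fix v assume v: "v \<in> V"
  have "B v (T_op s V r' (hat u)) = tensor_lift2 s V (\<lambda>a b. B v (s (hat u a) b)) r'"
    unfolding T_op_def
    by (rule lift2_compose[OF vector_space_axioms T_bil sub_V _ r'_TS vector_space_mult])
       (use u v in \<open>auto intro!: linear_onI simp: B_lin\<close>)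
  also have "\<dots> = pr (hat u) (hat v) r'" unfolding pair2_def
    by (rule tensor_lift2_cong) (use v in \<open>simp add: B_lin hat_apply\<close>)
  finally show "B (T_op s V r' (hat u)) v = B (- u) v"
    using u v skew[of "T_op s V r' (hat u)" v] by (simp add: pr_r' T_closed r'_TS B_lin)
qed (use u in \<open>simp_all add: T_closed r'_TS\<close>)

theorem factorizable: "factorizable s V M r"
proof -
  have "bij_betw (T_op s V r') V' V"
  proof (rule bij_betwI')
    fix f g assume "f \<in> V'" "g \<in> V'"
    then show "T_op s V r' f = T_op s V r' g \<longleftrightarrow> f = g"
      by (metis T_hat hat_exists neg_equal_iff_equal)
  next
    show "\<exists>f\<in>V'. y = T_op s V r' f" if "y \<in> V" for y
      using that by (intro bexI[of _ "hat (- y)"]) (simp_all add: T_hat)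
  qed (simp add: T_closed r'_TS)
  then show ?thesis unfolding factorizable_def quasi_triangular_def
    using r_TS bialgebra YBE invariant T_linear[OF r'_TS] by simp
qed

end

section \<open>The double of a perm bialgebra is a perm algebra\<close>

locale perm_bialg = A: fd_vs s A for s :: "'k::field_char_0 \<Rightarrow> 'a::ab_group_add
  \<Rightarrow> 'a" and A :: "'a set" +
  fixes mul :: "'a \<Rightarrow> 'a \<Rightarrow> 'a" and \<Delta> :: "'a \<Rightarrow> ('a, 'k)
    tensor2"
    and n :: nat and e :: "nat \<Rightarrow> 'a" and e' :: "nat \<Rightarrow> 'a \<Rightarrow> 'k"
  assumes bialg: "perm_bialgebra s A mul \<Delta>"
    and basis: "is_basis s A n e"
    and dual_basis: "is_dual_basis s A n e e'"
begin

abbreviation "A' \<equiv> dual_space s A"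
abbreviation "d \<equiv> dual_mult s A \<Delta>"
abbreviation "D \<equiv> A \<times> A'"
abbreviation "S \<equiv> double_scale s"
abbreviation "M \<equiv> double_mult s A mul d"
abbreviation "L a f \<equiv> transpose_map A (Lop mul a) f"
abbreviation "R a f \<equiv> transpose_map A (Rop mul a) f"

lemma \<Delta>_lin: "linear_on s tscale2 A A.TS \<Delta>"
  using bialg by (simp add: perm_bialgebra_def perm_coalgebra_def)

lemma perm: "perm_algebra s A mul" using bialg by (simp add: perm_bialgebra_def)

lemma mul_bil: "bilinear_on s s A A mul" using perm by (simp add: perm_algebra_def)
lemmas mul = bilinear_onD[OF mul_bil]
declare mul(1) [simp] A.dm_closed[OF \<Delta>_lin, simp]

lemma mul_assoc: "a \<in> A \<Longrightarrow> b \<in> A \<Longrightarrow> c \<in> A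
  \<Longrightarrow> mul a (mul b c) = mul (mul a b) c"
  and mul_left_comm: "a \<in> A \<Longrightarrow> b \<in> A \<Longrightarrow> c \<in> A
    \<Longrightarrow> mul (mul a b) c = mul (mul b a) c"
  using perm by (auto simp: perm_algebra_def)

lemma d_assoc: "f \<in> A' \<Longrightarrow> g \<in> A' \<Longrightarrow> h \<in> A'
  \<Longrightarrow> d f (d g h) = d (d f g) h"
  and d_left_comm: "f \<in> A' \<Longrightarrow> g \<in> A' \<Longrightarrow> h \<in> A'
    \<Longrightarrow> d (d f g) h = d (d g f) h"
proof -
  have "perm_coalgebra s A \<Delta>" using bialg by (simp only: perm_bialgebra_def)
  note this[unfolded A.perm_coalgebra_iff[OF \<Delta>_lin], rule_format]
  then show "f \<in> A' \<Longrightarrow> g \<in> A' \<Longrightarrow> h \<in> A' \<Longrightarrow>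
    d f (d g h) = d (d f g) h"
    "f \<in> A' \<Longrightarrow> g \<in> A' \<Longrightarrow> h \<in> A' \<Longrightarrow> d (d f
      g) h = d (d g f) h" by metis+
qed

lemma op_lin: assumes "a \<in> A"
  shows "linear_on s s A A (Lop mul a)" "linear_on s s A A (Rop mul a)" "linear_on s s A A (ad_op
    mul a)"
  using assms by (auto intro!: linear_onI simp: ad_op_def Lop_def Rop_def mul algebra_simps)

lemma LR_closed [simp]: "a \<in> A \<Longrightarrow> f \<in> A' \<Longrightarrow> L a f \<in> A'"
  "a \<in> A \<Longrightarrow> f \<in> A' \<Longrightarrow> R a f \<in> A'"
  by (simp_all add: op_lin)

lemma LR_apply: "x \<in> A \<Longrightarrow> L a f x = f (mul a x)" "x \<in> A \<Longrightarrow> R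
  a f x = f (mul x a)"
  by (simp_all add: transpose_map_def Lop_def Rop_def)

lemma ad_eq: "a \<in> A \<Longrightarrow> f \<in> A' \<Longrightarrow> transpose_map A (ad_op mul
  a) f = L a f - R a f"
  by (auto simp: transpose_map_def ad_op_def Lop_def Rop_def fun_eq_iff fun_apply A.dual_diff)

lemma dual_eqI: "f \<in> A' \<Longrightarrow> g \<in> A' \<Longrightarrow> (\<And>x. x \<in> A
  \<Longrightarrow> f x = g x) \<Longrightarrow> f = g"
  by (rule dual_space_eqI)

lemma d_add:
  assumes "f \<in> A'" "f' \<in> A'" "g \<in> A'"
  shows "d (f + f') g = d f g + d f' g" "d g (f + f') = d g f + d g f'"
proof -
  note D = linear_onD(1)[OF \<Delta>_lin]
  note P = A.pr_fun[OF D]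
  show "d (f + f') g = d f g + d f' g"
    by (rule dual_eqI) (simp_all add: assms fun_apply A.dm_apply[OF \<Delta>_lin] P(1))
  show "d g (f + f') = d g f + d g f'"
    by (rule dual_eqI) (simp_all add: assms fun_apply A.dm_apply[OF \<Delta>_lin] P(2))
qed

lemma d_scale:
  assumes "f \<in> A'" "g \<in> A'"
  shows "d (fscale c f) g = fscale c (d f g)" "d g (fscale c f) = fscale c (d g f)"
proof -
  note P = A.pr_fun[OF linear_onD(1)[OF \<Delta>_lin]]
  show "d (fscale c f) g = fscale c (d f g)"
    by (rule dual_eqI) (simp_all add: assms A.dm_apply[OF \<Delta>_lin] P(3), simp add: fscale_def
      A.dm_apply[OF \<Delta>_lin])
  show "d g (fscale c f) = fscale c (d g f)"
    by (rule dual_eqI) (simp_all add: assms A.dm_apply[OF \<Delta>_lin] P(4), simp add: fscale_def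
      A.dm_apply[OF \<Delta>_lin])
qed

lemma d_diff: "f \<in> A' \<Longrightarrow> f' \<in> A' \<Longrightarrow> g \<in> A'
  \<Longrightarrow> d (f - f') g = d f g - d f' g"
  "f \<in> A' \<Longrightarrow> f' \<in> A' \<Longrightarrow> g \<in> A' \<Longrightarrow> d g (f -
    f') = d g f - d g f'"
  using d_add(1)[of "f - f'" f' g] d_add(2)[of "f - f'" f' g] by auto

text \<open>The bialgebra conditions with everything on one side and \<open>ad\<close> split as
  \<open>L - R\<close>, so that only single evaluations of \<open>d\<close> remain.\<close>

lemma compat:
  assumes "a \<in> A" "b \<in> A" "f \<in> A'" "g \<in> A'"
  shows "d f g (mul a b) - d (L a f) g b + d (R a f) g b - d f (R b g) a = 0"
    "d (R b g) f a - d (R a f) g b = 0"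
    "d f g (mul a b) - d f (L a g) b - d (L b f) g a + d (R b f) g a + d g (L b f) a - d g (R b f)
      a = 0"
proof -
  have "d f g (mul a b) = d (transpose_map A (ad_op mul a) f) g b + d f (transpose_map A (Rop mul
    b) g) a \<and>
      d (transpose_map A (Rop mul b) g) f a = d (transpose_map A (Rop mul a) f) g b \<and>
      d f g (mul a b) = d f (transpose_map A (Lop mul a) g) b
        + (d (transpose_map A (ad_op mul b) f) g a - d g (transpose_map A (ad_op mul b) f) a)"
    by (rule bialg[unfolded A.perm_bialgebra_iff[OF \<Delta>_lin perm], THEN conjunct2,
      rule_format, OF assms])
  note * = conjunct1[OF this] conjunct1[OF conjunct2[OF this]] conjunct2[OF conjunct2[OF this]]
  show "d f g (mul a b) - d (L a f) g b + d (R a f) g b - d f (R b g) a = 0"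
    unfolding *(1) using assms by (simp add: ad_eq d_diff fun_apply)
  show "d (R b g) f a - d (R a f) g b = 0" using * by simp
  show "d f g (mul a b) - d f (L a g) b - d (L b f) g a + d (R b f) g a + d g (L b f) a - d g (R b
    f) a = 0"
    unfolding *(3) using assms by (simp add: ad_eq d_diff fun_apply)
qed

section \<open>Dual bases and transposes on the dual\<close>

lemma e_closed [simp]: "i \<in> {1..n} \<Longrightarrow> e i \<in> A" "i \<in> {1..n}
  \<Longrightarrow> e' i \<in> A'"
  using basis dual_basis A.span_superset[of "e ` {1..n}"] unfolding is_basis_def is_dual_basis_def
    by blast+

lemma e'_e: "i \<in> {1..n} \<Longrightarrow> j \<in> {1..n} \<Longrightarrow> e' i (e j) = (if i =
  j then 1 else 0)"
  using dual_basis by (auto simp: is_dual_basis_def)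

lemma sum_A: "(\<And>i. i \<in> I \<Longrightarrow> f i \<in> A) \<Longrightarrow> (\<Sum>i\<in>I.
  f i) \<in> A"
  by (rule A.subspace_sum[OF A.sub_V])

lemma sum_A': "(\<And>i. i \<in> I \<Longrightarrow> f i \<in> A') \<Longrightarrow>
  (\<Sum>i\<in>I. f i) \<in> A'"
  by (induction I rule: infinite_finite_induct) auto

lemma dual_sum:
  assumes "f \<in> A'" "\<And>i. i \<in> I \<Longrightarrow> x i \<in> A"
  shows "f (\<Sum>i\<in>I. s (c i) (x i)) = (\<Sum>i\<in>I. c i * f (x i))"
  using assms(2) by (induction I rule: infinite_finite_induct)
    (simp_all add: A.dual_zero[OF assms(1)] dual_spaceD[OF assms(1)] sum_A)

lemma sum_apply: "(\<Sum>i\<in>I. F i) x = (\<Sum>i\<in>I. F i x)"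
  by (induction I rule: infinite_finite_induct) (simp_all add: fun_apply)

lemma expand: assumes "x \<in> A" shows "(\<Sum>i=1..n. s (e' i x) (e i)) = x"
proof -
  have inj: "inj_on e {1..n}" and sp: "A.span (e ` {1..n}) = A"
    using basis by (auto simp: is_basis_def)
  obtain u where "x = (\<Sum>v\<in>e ` {1..n}. s (u v) v)"
    using assms sp A.span_finite[of "e ` {1..n}"] by auto
  then have x: "x = (\<Sum>i=1..n. s (u (e i)) (e i))" using sum.reindex[OF inj, of "\<lambda>v. s
    (u v) v"] by (simp only: o_def)
  have "e' j x = u (e j)" if j: "j \<in> {1..n}" for j
  proof -
    have "e' j x = (\<Sum>i=1..n. u (e i) * e' j (e i))" unfolding x
      by (rule dual_sum) (use j in auto)
    also have "\<dots> = (\<Sum>i=1..n. if j = i then u (e i) else 0)" using j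
      by (intro sum.cong) (auto simp: e'_e)
    finally show ?thesis using j by simp
  qed
  then have "(\<Sum>i=1..n. s (e' i x) (e i)) = (\<Sum>i=1..n. s (u (e i)) (e i))"
    by (intro sum.cong) simp_all
  then show ?thesis using x by simp
qed

lemma expand': assumes "f \<in> A'" shows "(\<Sum>i=1..n. fscale (f (e i)) (e' i)) = f"
proof (rule dual_eqI)
  fix x assume x: "x \<in> A"
  have "f x = (\<Sum>i=1..n. e' i x * f (e i))"
    by (subst expand[OF x, symmetric], rule dual_sum) (auto simp: assms)
  then show "(\<Sum>i=1..n. fscale (f (e i)) (e' i)) x = f x"
    by (simp add: sum_apply fscale_def mult.commute)
qed (auto simp: assms intro!: sum_A')

lemma separate: assumes "x \<in> A" "y \<in> A" "\<And>f. f \<in> A' \<Longrightarrow> f x = f y"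
  shows "x = y"
  by (metis (no_types, lifting) assms e_closed(2) expand sum.cong)

text \<open>Finite-dimensional reflexivity: the required vector is the sum of
  \<open>\<psi> (e' i) x\<close> times \<open>e i\<close>, and it is unique because functionals
  separate the points of \<open>A\<close>.\<close>

lemma transpose_dual:
  assumes "x \<in> A" "\<And>f. f \<in> A' \<Longrightarrow> \<psi> f \<in> A'"
    "\<And>f g. f \<in> A' \<Longrightarrow> g \<in> A' \<Longrightarrow> \<psi> (f + g) = \<psi> f
      + \<psi> g"
    "\<And>c f. f \<in> A' \<Longrightarrow> \<psi> (fscale c f) = fscale c (\<psi> f)"
  shows "transpose_dual s A \<psi> x \<in> A" "f \<in> A' \<Longrightarrow> f (transpose_dual s A
    \<psi> x) = \<psi> f x"
proof -
  define y where "y = (\<Sum>i=1..n. s (\<psi> (e' i) x) (e i))"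
  have y: "y \<in> A" unfolding y_def by (rule sum_A) auto
  have fy: "f y = \<psi> f x" if f: "f \<in> A'" for f
  proof -
    have 0: "\<psi> 0 = 0" using assms(4)[of 0 0] by (simp add: fscale_def zero_fun_def[symmetric])
    have "\<psi> (\<Sum>i\<in>I. fscale (c i) (e' i)) = (\<Sum>i\<in>I. fscale (c i) (\<psi> (e'
      i)))" if "I \<subseteq> {1..n}" "finite I" for I c
      using that(2,1) by (induction I) (simp_all add: 0 assms sum_A' subset_iff)
    then have "\<psi> f = (\<Sum>i=1..n. fscale (f (e i)) (\<psi> (e' i)))"
      by (metis expand'[OF f] finite_atLeastAtMost subset_refl)
    then have "\<psi> f x = (\<Sum>i=1..n. \<psi> (e' i) x * f (e i))"
      by (simp add: sum_apply fscale_def mult.commute)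
    also have "\<dots> = f y" unfolding y_def by (rule dual_sum[OF f, symmetric]) auto
    finally show ?thesis by simp
  qed
  have "transpose_dual s A \<psi> x = y" unfolding transpose_dual_def
    by (rule the_equality) (use y fy separate in \<open>metis+\<close>)
  then show "transpose_dual s A \<psi> x \<in> A" "f \<in> A' \<Longrightarrow> f (transpose_dual s
    A \<psi> x) = \<psi> f x"
    using y fy by auto
qed

lemma d_transpose:
  assumes "x \<in> A" "g \<in> A'"
  shows "transpose_dual s A (Lop d g) x \<in> A" "transpose_dual s A (ad_op d g) x \<in> A"
    "f \<in> A' \<Longrightarrow> f (transpose_dual s A (Lop d g) x) = d g f x"
    "f \<in> A' \<Longrightarrow> f (transpose_dual s A (ad_op d g) x) = d g f x - d f g x"
proof -
  have fd: "fscale c (u - v) = fscale c u - fscale c v" for c and u v :: "'a \<Rightarrow> 'k"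
    by (simp add: fscale_def fun_eq_iff fun_apply algebra_simps)
  have "Lop d g f \<in> A'" "Lop d g (f + h) = Lop d g f + Lop d g h" "Lop d g (fscale c f) =
    fscale c (Lop d g f)"
    "ad_op d g f \<in> A'" "ad_op d g (f + h) = ad_op d g f + ad_op d g h" "ad_op d g (fscale c f)
      = fscale c (ad_op d g f)"
    if "f \<in> A'" "h \<in> A'" for f h c
    using assms that by (simp_all add: Lop_def ad_op_def Rop_def d_add d_scale fd)
  note T = transpose_dual[OF assms(1), of "Lop d g", OF this(1-3)]
    transpose_dual[OF assms(1), of "ad_op d g", OF this(4-6)]
  show "transpose_dual s A (Lop d g) x \<in> A" "transpose_dual s A (ad_op d g) x \<in> A"
    "f \<in> A' \<Longrightarrow> f (transpose_dual s A (Lop d g) x) = d g f x"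
    "f \<in> A' \<Longrightarrow> f (transpose_dual s A (ad_op d g) x) = d g f x - d f g x"
    using T by (auto simp: Lop_def ad_op_def Rop_def fun_apply)
qed

section \<open>Components of the double product\<close>

lemma snd_M: "x \<in> D \<Longrightarrow> y \<in> D \<Longrightarrow>
  snd (M x y) = d (snd x) (snd y) + L (fst x) (snd y) + (L (fst y) (snd x) - R (fst y) (snd x))"
  by (auto simp: double_mult_def ad_eq)

text \<open>The first component contains definite descriptions known only through their values under
  functionals, hence the formulation with \<open>h\<close> applied.\<close>

lemma fst_M:
  assumes "x \<in> D" "y \<in> D"
  shows "fst (M x y) \<in> A"
    "h \<in> A' \<Longrightarrow> h (fst (M x y)) = h (mul (fst x) (fst y)) + d (snd x) h (fst y)
      + (d (snd y) h (fst x) - d h (snd y) (fst x))"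
  using assms by (auto simp: double_mult_def d_transpose dual_spaceD)

lemma M_closed [simp]: "x \<in> D \<Longrightarrow> y \<in> D \<Longrightarrow> M x y \<in> D"
  unfolding mem_Times_iff by (simp add: fst_M(1) snd_M mem_Times_iff)

text \<open>Multiplication by \<open>a\<close> is absorbed into the functional as
  \<open>L a h\<close> or \<open>R a h\<close>, to which \<open>fst_M\<close> applies.\<close>

lemma fst_M_mul:
  assumes "x \<in> D" "y \<in> D" "a \<in> A" "h \<in> A'"
  shows "h (mul a (fst (M x y))) = L a h (mul (fst x) (fst y)) + d (snd x) (L a h) (fst y)
      + (d (snd y) (L a h) (fst x) - d (L a h) (snd y) (fst x))"
    "h (mul (fst (M x y)) a) = R a h (mul (fst x) (fst y)) + d (snd x) (R a h) (fst y)
      + (d (snd y) (R a h) (fst x) - d (R a h) (snd y) (fst x))"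
  using fst_M(2)[OF assms(1,2), of "L a h"] fst_M(2)[OF assms(1,2), of "R a h"] assms fst_M(1)[OF
    assms(1,2)]
  by (simp_all add: LR_apply)

lemma D_eqI:
  assumes "x \<in> D" "y \<in> D" "\<And>h. h \<in> A' \<Longrightarrow> h (fst x) = h (fst y)"
    "\<And>t. t \<in> A \<Longrightarrow> snd x t = snd y t"
  shows "x = y"
  using assms separate[of "fst x" "fst y"] dual_eqI[of "snd x" "snd y"] by (auto simp:
    mem_Times_iff prod_eq_iff)

text \<open>The three compatibility conditions say that these vanish. The linear combinations of
  them in
  \<open>double_assoc\<close> and \<open>double_left_comm\<close> were found by Gaussian
    elimination.\<close>

definition "defect1 a b f g = d f g (mul a b) - d (L a f) g b + d (R a f) g b - d f (R b g) a"
definition "defect2 a b f g = d (R b g) f a - d (R a f) g b"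
definition "defect3 a b f g = d f g (mul a b) - d f (L a g) b - d (L b f) g a + d (R b f) g a + d g
  (L b f) a - d g (R b f) a"

lemma d_snd_M:
  assumes x: "x \<in> D" and y: "y \<in> D" and h: "h \<in> A'"
  shows "d (snd (M x y)) h = d (d (snd x) (snd y)) h + d (L (fst x) (snd y)) h
      + (d (L (fst y) (snd x)) h - d (R (fst y) (snd x)) h)"
    "d h (snd (M x y)) = d h (d (snd x) (snd y)) + d h (L (fst x) (snd y))
      + (d h (L (fst y) (snd x)) - d h (R (fst y) (snd x)))"
proof -
  have "fst x \<in> A" "fst y \<in> A" "snd x \<in> A'" "snd y \<in> A'"
    using x y by (auto simp: mem_Times_iff)
  then show "d (snd (M x y)) h = d (d (snd x) (snd y)) h + d (L (fst x) (snd y)) h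
      + (d (L (fst y) (snd x)) h - d (R (fst y) (snd x)) h)"
    "d h (snd (M x y)) = d h (d (snd x) (snd y)) + d h (L (fst x) (snd y))
      + (d h (L (fst y) (snd x)) - d h (R (fst y) (snd x)))"
    unfolding snd_M[OF x y] using h by (simp_all add: d_add d_diff)
qed

section \<open>Products of three elements of the double\<close>

context
  fixes x y z a f b g c k
  assumes x: "x \<in> D" and y: "y \<in> D" and z: "z \<in> D"
    and xyz: "x = (a, f)" "y = (b, g)" "z = (c, k)"
begin

lemma components_closed: "a \<in> A" "b \<in> A" "c \<in> A" "f \<in> A'" "g \<in> A'" "k \<in> A'"
  using x y z xyz by auto

lemma xyz_components: "fst x = a" "fst y = b" "fst z = c" "snd x = f" "snd y = g" "snd z = k"
  using xyz by auto

lemma fst_right: assumes h: "h \<in> A'"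
  shows "h (fst (M x (M y z))) = h (mul a (mul b c)) + d g (L a h) c + d k (L a h) b - d (L a h) k b
     + d f h (mul b c) + d g (d f h) c + d k (d f h) b - d (d f h) k b
     + d (d g k) h a + d (L b k) h a + d (L c g) h a - d (R c g) h a
     - d h (d g k) a - d h (L b k) a - d h (L c g) a + d h (R c g) a"
proof -
  \<comment> \<open>\<open>d f h\<close> is again a functional, so \<open>fst_M\<close> also
    evaluates it on the first component of \<open>M y z\<close>.\<close>
  have m: "d f h \<in> A'" using components_closed h by simp
  show ?thesis
    unfolding fst_M(2)[OF x M_closed[OF y z] h, unfolded xyz_components] fst_M_mul(1)[OF y z
      components_closed(1) h, unfolded xyz_components]
      fst_M(2)[OF y z m, unfolded xyz_components] d_snd_M[OF y z h, unfolded xyz_components]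
    using components_closed h by (simp add: fun_apply LR_apply)
qed

lemma fst_left: assumes h: "h \<in> A'"
  shows "h (fst (M (M x y) z)) = h (mul (mul a b) c) + d f (R c h) b + d g (R c h) a - d (R c h) g a
     + d (d f g) h c + d (L a g) h c + d (L b f) h c - d (R b f) h c
     + d k h (mul a b) + d f (d k h) b + d g (d k h) a - d (d k h) g a
     - d h k (mul a b) - d f (d h k) b - d g (d h k) a + d (d h k) g a"
proof -
  have m: "d k h \<in> A'" "d h k \<in> A'" using components_closed h by simp_all
  show ?thesis
    unfolding fst_M(2)[OF M_closed[OF x y] z h, unfolded xyz_components] fst_M_mul(2)[OF x y
      components_closed(3) h, unfolded xyz_components]
      fst_M(2)[OF x y m(1), unfolded xyz_components] fst_M(2)[OF x y m(2), unfolded xyz_components]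
        d_snd_M[OF x y h, unfolded xyz_components]
    using components_closed h by (simp add: fun_apply LR_apply)
qed

text \<open>The first component of the inner product enters only inside \<open>f\<close>, multiplied
  by \<open>t\<close> on either side, so \<open>fst_M_mul\<close> removes its definite
  descriptions.\<close>

lemma snd_right: assumes t: "t \<in> A"
  shows "snd (M x (M y z)) t = d f (d g k) t + d f (L b k) t + d f (L c g) t - d f (R c g) t
     + d g k (mul a t) + k (mul b (mul a t)) + g (mul c (mul a t)) - g (mul (mul a t) c)
     + f (mul (mul b c) t) + d g (R t f) c + d k (R t f) b - d (R t f) k b
     - f (mul t (mul b c)) - d g (L t f) c - d k (L t f) b + d (L t f) k b"
proof -
  have Y: "fst (M y z) \<in> A" "mul a t \<in> A" using fst_M(1)[OF y z] components_closed t by auto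
  show ?thesis
    unfolding snd_M[OF x M_closed[OF y z], unfolded xyz_components] fun_apply d_snd_M[OF y z
      components_closed(4), unfolded xyz_components]
      LR_apply[OF t] LR_apply[OF Y(1)] fst_M_mul[OF y z t components_closed(4), unfolded
        xyz_components]
    unfolding snd_M[OF y z, unfolded xyz_components]
    using components_closed t by (simp add: fun_apply LR_apply)
qed

lemma snd_left: assumes t: "t \<in> A"
  shows "snd (M (M x y) z) t = d (d f g) k t + d (L a g) k t + d (L b f) k t - d (R b f) k t
     + k (mul (mul a b) t) + d f (R t k) b + d g (R t k) a - d (R t k) g a
     + d f g (mul c t) + g (mul a (mul c t)) + f (mul b (mul c t)) - f (mul (mul c t) b)
     - d f g (mul t c) - g (mul a (mul t c)) - f (mul b (mul t c)) + f (mul (mul t c) b)"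
proof -
  have Y: "fst (M x y) \<in> A" "mul c t \<in> A" "mul t c \<in> A" using fst_M(1)[OF x y]
    components_closed t by auto
  show ?thesis
    unfolding snd_M[OF M_closed[OF x y] z, unfolded xyz_components] fun_apply d_snd_M[OF x y
      components_closed(6), unfolded xyz_components]
      LR_apply[OF t] LR_apply[OF Y(1)] fst_M_mul[OF x y t components_closed(6), unfolded
        xyz_components]
    unfolding snd_M[OF x y, unfolded xyz_components]
    using components_closed t by (simp add: fun_apply LR_apply)
qed

end

lemma defect_zero:
  assumes "a \<in> A" "b \<in> A" "f \<in> A'" "g \<in> A'"
  shows "defect1 a b f g = 0" "defect2 a b f g = 0" "defect3 a b f g = 0"
  using compat[OF assms] by (simp_all only: defect1_def defect2_def defect3_def)

lemma double_assoc:
  assumes x: "x \<in> D" and y: "y \<in> D" and z: "z \<in> D"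
  shows "M x (M y z) = M (M x y) z"
proof -
  obtain a f b g c k where xyz: "x = (a, f)" "y = (b, g)" "z = (c, k)" by (metis surj_pair)
  note components_closed = components_closed[OF x y z xyz]
  show ?thesis
  proof (rule D_eqI)
    fix h assume h: "h \<in> A'"
    \<comment> \<open>Equality modulo the perm laws of \<open>mul\<close> and \<open>d\<close>,
      which account for all terms outside the defects.\<close>
    have "h (fst (M x (M y z))) - h (fst (M (M x y) z)) =
      defect1 a b h k + defect1 b c f h + defect2 a c g h - defect3 a b k h + defect2 a b h k -
        defect3 a c g h + defect1 a c g h"
      unfolding fst_right[OF x y z xyz h] fst_left[OF x y z xyz h] defect1_def defect2_def
        defect3_def
      using components_closed h by (simp add: mul_assoc d_assoc mul_left_comm d_left_comm)
    then show "h (fst (M x (M y z))) = h (fst (M (M x y) z))"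
      using components_closed h by (simp add: defect_zero)
  next
    fix t assume t: "t \<in> A"
    have "snd (M x (M y z)) t - snd (M (M x y) z) t =
      defect1 a t g k + defect1 t c f g + defect2 a t g k - defect3 b t f k + defect1 b t f k -
        defect3 c t f g"
      unfolding snd_right[OF x y z xyz t] snd_left[OF x y z xyz t] defect1_def defect2_def
        defect3_def
      using components_closed t by (simp add: mul_assoc d_assoc mul_left_comm d_left_comm)
    then show "snd (M x (M y z)) t = snd (M (M x y) z) t"
      using components_closed t by (simp add: defect_zero)
  qed (use x y z in simp_all)
qed

lemma double_left_comm:
  assumes x: "x \<in> D" and y: "y \<in> D" and z: "z \<in> D"
  shows "M (M x y) z = M (M y x) z"
proof -
  obtain a f b g c k where xyz: "x = (a, f)" "y = (b, g)" "z = (c, k)" by (metis surj_pair)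
  \<comment> \<open>With \<open>x\<close> and \<open>y\<close> exchanged, the same expansions serve
    for the other side.\<close>
  note components_closed = components_closed[OF x y z xyz] and yxz = xyz(2,1,3)
  show ?thesis
  proof (rule D_eqI)
    fix h assume h: "h \<in> A'"
    have "h (fst (M (M x y) z)) - h (fst (M (M y x) z)) =
      defect1 a b k h + defect1 b a h k - defect2 a c g h + defect2 b c f h - defect3 b a k h -
        defect3 a b h k"
      unfolding fst_left[OF x y z xyz h] fst_left[OF y x z yxz h] defect1_def defect2_def
        defect3_def
      using components_closed h by (simp add: mul_assoc d_assoc mul_left_comm d_left_comm)
    then show "h (fst (M (M x y) z)) = h (fst (M (M y x) z))"
      using components_closed h by (simp add: defect_zero)
  next
    fix t assume t: "t \<in> A"
    have "snd (M (M x y) z) t - snd (M (M y x) z) t =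
      defect1 c t f g + defect1 t c g f - defect2 a t g k + defect2 b t f k - defect3 t c f g -
        defect3 c t g f"
      unfolding snd_left[OF x y z xyz t] snd_left[OF y x z yxz t] defect1_def defect2_def
        defect3_def
      using components_closed t by (simp add: mul_assoc d_assoc mul_left_comm d_left_comm)
    then show "snd (M (M x y) z) t = snd (M (M y x) z) t"
      using components_closed t by (simp add: defect_zero)
  qed (use x y z in simp_all)
qed

end

section \<open>The double as a Manin triple\<close>

context perm_bialg
begin

definition "form x y = snd y (fst x) - snd x (fst y)" for x y :: "'a \<times> ('a \<Rightarrow> 'k)"

lemma S_simps [simp]: "fst (S c x) = s c (fst x)" "snd (S c x) = fscale c (snd x)"
  by (simp_all add: double_scale_def split_beta)

lemma vector_space_S: "vector_space S"
proof -
  interpret f: vector_space "fscale :: 'k \<Rightarrow> ('a \<Rightarrow> 'k) \<Rightarrow> _" by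
    (rule vector_space_fscale)
  show ?thesis
    by unfold_locales (simp_all add: prod_eq_iff A.scale_right_distrib A.scale_left_distrib
      f.scale_right_distrib f.scale_left_distrib)
qed

lemma sum_S_A: assumes "x \<in> A" shows "(\<Sum>i=1..n. S (e' i x) (e i, 0)) = (x, 0)"
proof -
  have 0: "fscale c (0 :: 'a \<Rightarrow> 'k) = 0" for c by (simp add: fscale_def fun_eq_iff
    fun_apply)
  show ?thesis by (simp add: prod_eq_iff fst_sum snd_sum expand[OF assms] 0 del: One_nat_def)
qed

lemma sum_S_A': assumes "f \<in> A'" shows "(\<Sum>i=1..n. S (f (e i)) (0, e' i)) = (0, f)"
  by (simp add: prod_eq_iff fst_sum snd_sum expand'[OF assms] del: One_nat_def)

lemma fd_D: "fd_space S D"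
proof -
  interpret v: vector_space S by (rule vector_space_S)
  define E where "E = (\<lambda>i. (e i, 0)) ` {1..n} \<union> (\<lambda>i. (0, e' i)) ` {1..n}"
  have sD: "v.subspace D" by (rule v.subspaceI) (auto simp: mem_Times_iff)
  have "v.span E = D"
  proof
    show "v.span E \<subseteq> D" by (rule v.span_minimal[OF _ sD]) (auto simp: E_def)
    show "D \<subseteq> v.span E"
    proof
      fix x assume x: "x \<in> D"
      have "(\<Sum>i=1..n. S (e' i (fst x)) (e i, 0)) + (\<Sum>i=1..n. S (snd x (e i)) (0, e' i))
        \<in> v.span E"
        by (intro v.span_add v.span_sum v.span_scale v.span_base) (auto simp: E_def)
      then show "x \<in> v.span E" using x
        unfolding sum_S_A[OF mem_Times_iff[THEN iffD1, OF x, THEN conjunct1]]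
          sum_S_A'[OF mem_Times_iff[THEN iffD1, OF x, THEN conjunct2]] by simp
    qed
  qed
  moreover have "finite E" by (simp add: E_def)
  ultimately show ?thesis using vector_space_S by (auto simp: fd_space_def)
qed

lemma zero_ops: "f \<in> A' \<Longrightarrow> d 0 f = 0" "f \<in> A' \<Longrightarrow> d f 0 = 0"
  "L a 0 = 0" "R a 0 = 0"
  using d_diff(1)[of 0 0 f] d_diff(2)[of 0 0 f]
  by (auto simp: transpose_map_def fun_eq_iff fun_apply)

text \<open>Checked through \<open>D_eqI\<close>, since first components are accessible only under
  functionals.\<close>

lemma M_bil: "bilinear_on S S D D M"
proof -
  have 0: "fst x \<in> A" "snd x \<in> A'" if "x \<in> D" for x using that by (auto simp:
    mem_Times_iff)
  have f: "fscale c f x = c * f x" for c and f :: "'a \<Rightarrow> 'k" and x by (simp add: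
    fscale_def)
  have SD: "x \<in> D \<Longrightarrow> S c x \<in> D" "x \<in> D \<Longrightarrow> y \<in> D
    \<Longrightarrow> x + y \<in> D" for c x y
    by (auto simp: mem_Times_iff)
  note simps = 0 fst_M snd_M mul d_add d_scale dual_spaceD[of _ s A] SD LR_apply fun_apply f
    algebra_simps
  show ?thesis
  proof (rule bilinear_onI)
    fix x x' y assume "x \<in> D" "x' \<in> D" "y \<in> D"
    then show "M (x + x') y = M x y + M x' y" "M y (x + x') = M y x + M y x'"
      by (rule_tac [!] D_eqI) (simp_all add: simps del: mem_Sigma_iff)
  next
    fix c x y assume "x \<in> D" "y \<in> D"
    then show "M (S c x) y = S c (M x y)" "M x (S c y) = S c (M x y)"
      by (rule_tac [!] D_eqI) (simp_all add: simps del: mem_Sigma_iff)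
  qed simp
qed

sublocale manin S D M form "\<lambda>x. (fst x, 0)" "\<lambda>x. (0, snd x)" n "\<lambda>i. (e i,
  0)" "\<lambda>i. (0, e' i)"
proof
  have 0: "fst x \<in> A" "snd x \<in> A'" if "x \<in> D" for x using that by (auto simp:
    mem_Times_iff)
  have f: "fscale c f x = c * f x" for c and f :: "'a \<Rightarrow> 'k" and x by (simp add:
    fscale_def)
  have fz: "fscale c 0 = (0 :: 'a \<Rightarrow> 'k)" for c by (simp add: fscale_def fun_eq_iff
    fun_apply)
  show "fd_space S D" by (rule fd_D)
  show "perm_algebra S D M"
    unfolding perm_algebra_def using fd_D M_bil double_assoc double_left_comm by blast
  show "bilinear_on S (*) D UNIV form"
    by (rule bilinear_onI) (auto simp: form_def 0 fun_apply f dual_spaceD[of _ s A] algebra_simps)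
  show "form x y = - form y x" for x y by (simp add: form_def)
  \<comment> \<open>Pairing with \<open>(0, h)\<close> detects the first component and pairing with
    \<open>(t, 0)\<close> the second.\<close>
  show "x = 0" if x: "x \<in> D" and z: "\<And>y. y \<in> D \<Longrightarrow> form x y = 0" for x
  proof (rule D_eqI[OF x])
    show "h (fst x) = h (fst 0)" if "h \<in> A'" for h
      using z[of "(0, h)"] that 0[OF x] by (simp add: form_def A.dual_zero)
    show "snd x t = snd 0 t" if "t \<in> A" for t
      using z[of "(t, 0)"] that 0[OF x] by (simp add: form_def fun_apply)
  qed (simp add: mem_Times_iff)
  \<comment> \<open>In the commutator the contributions symmetric in \<open>y\<close> and
    \<open>z\<close> drop out; the remaining evaluations coincide with those on the left.\<close>
  show "form (M x y) z = form x (M y z - M z y)" if "x \<in> D" "y \<in> D" "z \<in> D" for x y z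
    using that 0 by (simp add: form_def fst_M snd_M A.dual_diff LR_apply fun_apply algebra_simps
      del: mem_Sigma_iff)
  show "linear_on S S D D (\<lambda>x. (0, snd x))"
    by (rule linear_onI) (auto simp: prod_eq_iff)
  show "(fst x, 0) + (0, snd x) = x" for x :: "'a \<times> ('a \<Rightarrow> 'k)" by (simp add:
    prod_eq_iff)
  show "form (0, snd x) y = form x (fst y, 0)" if "x \<in> D" "y \<in> D" for x y
    using that 0 by (simp add: form_def A.dual_zero fun_apply)
  show "(0, snd (M (fst x, 0) (fst y, 0))) = 0" if "x \<in> D" "y \<in> D" for x y
    using that 0 by (simp add: snd_M zero_ops prod_eq_iff)
  show "(fst (M (0, snd x) (0, snd y)), 0) = 0" if "x \<in> D" "y \<in> D" for x y
  proof -
    have m: "mul 0 0 = 0" using mul(3)[of 0 0 0] by simp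
    have xy: "(0, snd x) \<in> D" "(0, snd y) \<in> D" using 0 that by auto
    have "fst (M (0, snd x) (0, snd y)) = 0"
      by (rule separate) (use that 0 xy in \<open>simp_all add: fst_M A.dual_zero m del:
        mem_Sigma_iff\<close>)
    then show ?thesis by (simp add: prod_eq_iff)
  qed
  \<comment> \<open>The sign comes from \<open>form u (e i, 0) = - snd u (e i)\<close>.\<close>
  show "(\<Sum>i=1..n. S (form u (e i, 0)) (0, e' i)) = - (0, snd u)" if "u \<in> D" for u
    using sum_S_A'[of "- snd u"] 0[OF that] by (simp add: form_def fun_apply prod_eq_iff)
  show "(\<Sum>i=1..n. S (form u (0, e' i)) (e i, 0)) = (fst u, 0)" if "u \<in> D" for u
    using sum_S_A[of "fst u"] 0[OF that] A.dual_zero[OF 0(2)[OF that]] by (simp add: form_def)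
  show "\<exists>u\<in>D. \<forall>x\<in>D. F x = form u x" if F: "F \<in> dual_space S D" for F
  proof -
    \<comment> \<open>Both components are forced: pairing \<open>u\<close> with
      \<open>(0, f)\<close> evaluates \<open>f\<close> at \<open>fst u\<close>, which the dual basis
      determines, and pairing with \<open>(a, 0)\<close> gives \<open>- snd u a\<close>, whence the
      minus sign.\<close>
    define u where "u = ((\<Sum>i=1..n. s (F (0, e' i)) (e i)), (\<lambda>a. if a \<in> A then - F
      (a, 0) else 0))"
    have Fadd: "F (x + y) = F x + F y" "F (S c x) = c * F x" if "x \<in> D" "y \<in> D" for c x y
      using F that by (auto simp: dual_space_def linear_on_def)
    have F0: "F 0 = 0" using Fadd(2)[of 0 0 0] by (simp add: double_scale_def zero_prod_def fz)
    have F1: "F (a + b, 0) = F (a, 0) + F (b, 0)" if "a \<in> A" "b \<in> A" for a b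
      using Fadd(1)[of "(a, 0)" "(b, 0)"] that by simp
    have F2: "F (s c a, 0) = c * F (a, 0)" if "a \<in> A" for a c
      using Fadd(2)[of "(a, 0)" "(a, 0)"] that by (simp add: double_scale_def fz)
    have "linear_on s (*) A UNIV (snd u)"
      by (rule linear_onI) (simp_all add: u_def F1 F2)
    moreover have "snd u a = 0" if "a \<notin> A" for a using that by (simp add: u_def)
    ultimately have "snd u \<in> A'" unfolding dual_space_def[of s A] by blast
    moreover have "fst u \<in> A" unfolding u_def by (auto intro!: sum_A)
    moreover have "F x = form u x" if x: "x \<in> D" for x
    proof -
      have sF: "F (\<Sum>i\<in>I. S (c i) (0, e' i)) = (\<Sum>i\<in>I. c i * F (0, e' i)) \<and>
        (\<Sum>i\<in>I. S (c i) (0, e' i)) \<in> D"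
        if "I \<subseteq> {1..n}" "finite I" for I c
        using that(2,1) by (induction I) (auto simp: F0 Fadd mem_Times_iff)
      have "F (0, snd x) = (\<Sum>i=1..n. snd x (e i) * F (0, e' i))"
        unfolding sum_S_A'[OF 0(2)[OF x], symmetric]
        using conjunct1[OF sF[OF subset_refl finite_atLeastAtMost]] by simp
      also have "\<dots> = snd x (fst u)" unfolding u_def using 0[OF x]
        using dual_sum[of "snd x" "{1..n}" e "\<lambda>i. F (0, e' i)"] by (simp add: mult.commute
          del: One_nat_def)
      finally have "F (0, snd x) = snd x (fst u)" .
      moreover have "F x = F (fst x, 0) + F (0, snd x)"
        using Fadd(1)[of "(fst x, 0)" "(0, snd x)"] 0[OF x] by simp
      ultimately show ?thesis using 0[OF x] by (simp add: form_def u_def)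
    qed
    ultimately show ?thesis by (intro bexI[of _ u]) (auto simp: mem_Times_iff)
  qed
qed (auto simp: mem_Times_iff)

end

theorem theorem3p6:
  fixes s :: "'k::field_char_0 \<Rightarrow> 'a::ab_group_add \<Rightarrow> 'a"
    and A :: "'a set"
    and mul :: "'a \<Rightarrow> 'a \<Rightarrow> 'a"
    and \<Delta> :: "'a \<Rightarrow> ('a, 'k) tensor2"
    and n :: nat
    and e :: "nat \<Rightarrow> 'a"
    and e' :: "nat \<Rightarrow> 'a \<Rightarrow> 'k"
  assumes "perm_bialgebra s A mul \<Delta>"
    and "is_basis s A n e"
    and "is_dual_basis s A n e e'"
  shows "factorizable (double_scale s) (A \<times> dual_space s A)
           (double_mult s A mul (dual_mult s A \<Delta>))
           (\<Sum>i=1..n. tens2 (double_scale s) (e i, 0) (0, e' i))"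
proof -
  have "fd_space s A" using assms(1) by (simp only: perm_bialgebra_def perm_algebra_def)
  then interpret perm_bialg s A mul \<Delta> n e e' using assms by unfold_locales
  \<comment> \<open>For the families \<open>(e i, 0)\<close> and \<open>(0, e' i)\<close> the tensor
    \<open>r\<close> of the triple unfolds to the sum in the goal.\<close>
  show ?thesis using factorizable by (simp only: r_def)
qed

end
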